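(* Let $\mathcal{H}$ be a real Hilbert space with scalar product $((\cdot,\cdot))$ and norm $\|\cdot\|$, identified with its dual, let $T>0$, and let $\mathcal{F},\mathcal{F}_T:\mathcal{H}\to\mathbb{R}$ be continuously differentiable functionals with gradients $D_X\mathcal{F},D_X\mathcal{F}_T$ such that, for some constant $c$ and all $X_1,X_2\in\mathcal{H}$, $$\|D_X\mathcal{F}(X_1)-D_X\mathcal{F}(X_2)\|\le c\|X_1-X_2\|,\qquad \|D_X\mathcal{F}_T(X_1)-D_X\mathcal{F}_T(X_2)\|\le c\|X_1-X_2\|,$$ $$\|D_X\mathcal{F}(0)\|\le c,\qquad \|D_X\mathcal{F}_T(0)\|\le c .$$ Assume $$\lambda>cT(1+T).$$ For $X\in\mathcal{H}$, $t\in[0,T]$ and $v(\cdot)\in L^2(t,T;\mathcal{H})$ let $X(s)$ be the state defined by $\frac{dX}{ds}=v(s)$, $X(t)=X$, let $$J_{Xt}(v(\cdot))=\frac{\lambda}{2}\int_t^T\|v(s)\|^2ds+\int_t^T\mathcal{F}(X(s))\,ds+\mathcal{F}_T(X(T)),$$ and let $V(X,t)=\inf_{v(\cdot)}J_{Xt}(v(\cdot))$ be the value function. Then: (i) $V$ is $C^1$ and there is a constant $C$ such that for all $X,t$ $$|V(X,t)|\le C(1+\|X\|^2),\quad \|D_XV(X,t)\|\le C(1+\|X\|),\quad \left|\frac{\partial V(X,t)}{\partial t}\right|\le C(1+\|X\|^2). \qquad (a)$$ (ii) There is a constant $C$ such that for all $X^1,X^2\in\mathcal{H}$ and all $t^1,t^2$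 $$\|D_XV(X^1,t^1)-D_XV(X^2,t^2)\|\le C\|X^1-X^2\|+C|t^1-t^2|(1+\|X^1\|+\|X^2\|),$$ $$\left|\frac{\partial V(X^1,t^1)}{\partial t}-\frac{\partial V(X^2,t^2)}{\partial t}\right|\le C\|X^1-X^2\|(1+\|X^1\|+\|X^2\|)+C|t^1-t^2|(1+\|X^1\|^2+\|X^2\|^2). \qquad (b)$$ (iii) $V$ is the unique solution, among ($C^1$) functions satisfying conditions of the form (a) and (b), of the Bellman equation $$\frac{\partial V}{\partial t}-\frac{1}{2\lambda}\|D_XV\|^2+\mathcal{F}(X)=0,\qquad V(X,T)=\mathcal{F}_T(X).$$ (iv) The control problem of minimizing $J_{Xt}(v(\cdot))$ over $v(\cdot)\in L^2(t,T;\mathcal{H})$ has a unique solution.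
   Context: $D_X$ denotes the gradient in $\mathcal{H}$ (with $\mathcal{H}$ identified with its dual, so $D_X\mathcal{F}(X)\in\mathcal{H}$). $L^2(t,T;\mathcal{H})$ is the space of square integrable $\mathcal{H}$-valued functions on $(t,T)$; the state $X(\cdot)$ then belongs to the Sobolev space $H^1(t,T;\mathcal{H})$. $C$ denotes a generic constant, independent of $X$ and $t$. *)

theory Defs
  imports "HOL-Analysis.Analysis"
begin

text \<open>
  A real Hilbert space is a type of sort \<open>{real_inner, banach}\<close>; separability is not assumed.
  The library's Bochner integral requires a second countable codomain, hence the explicit notion
  of strong measurability (almost everywhere limit of simple functions) below, and the use of the
  Henstock--Kurzweil integral for Hilbert space valued integrands.
\<close>

definition strongly_measurable :: "'b measure \<Rightarrow> ('b \<Rightarrow> 'a::topological_space) \<Rightarrow> bool" where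
  "strongly_measurable M f \<longleftrightarrow>
     (\<exists>g :: nat \<Rightarrow> 'b \<Rightarrow> 'a.
        (\<forall>n. simple_function M (g n)) \<and> (AE x in M. (\<lambda>n. g n x) \<longlonglongrightarrow> f x))"

text \<open>
  Representatives of the elements of \<open>L\<^sup>2(t,T;H)\<close>. They are total functions on the reals; their
  values outside \<open>{t..T}\<close> are irrelevant, and two of them represent the same element if they
  agree almost everywhere on \<open>{t..T}\<close>.
\<close>

definition L2_controls :: "real \<Rightarrow> real \<Rightarrow> (real \<Rightarrow> 'a::{real_inner, banach}) set" where
  "L2_controls t T =
     {v. strongly_measurable (lebesgue_on {t..T}) v \<and>
         integrable (lebesgue_on {t..T}) (\<lambda>s. (norm (v s))\<^sup>2)}"

text \<open>
  The solution in \<open>H\<^sup>1(t,T;H)\<close> of \<open>dX/ds = v(s)\<close>, \<open>X(t) = x\<close>. A control in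
  \<open>L\<^sup>2(t,T;H)\<close> is Bochner integrable, hence Henstock--Kurzweil integrable with the same integral.
\<close>

definition trajectory :: "real \<Rightarrow> 'a \<Rightarrow> (real \<Rightarrow> 'a::{real_inner, banach}) \<Rightarrow> real \<Rightarrow> 'a" where
  "trajectory t x v s = x + integral {t..s} v"

definition cost ::
  "real \<Rightarrow> real \<Rightarrow> ('a \<Rightarrow> real) \<Rightarrow> ('a \<Rightarrow> real) \<Rightarrow> 'a \<Rightarrow> real \<Rightarrow> (real \<Rightarrow> 'a::{real_inner, banach}) \<Rightarrow> real"
where
  "cost lam T F FT x t v =
     lam / 2 * (LINT s|lebesgue_on {t..T}. (norm (v s))\<^sup>2)
     + (LINT s|lebesgue_on {t..T}. F (trajectory t x v s))
     + FT (trajectory t x v T)"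

definition value_function ::
  "real \<Rightarrow> real \<Rightarrow> ('a \<Rightarrow> real) \<Rightarrow> ('a \<Rightarrow> real) \<Rightarrow> 'a::{real_inner, banach} \<Rightarrow> real \<Rightarrow> real"
where
  "value_function lam T F FT x t = (INF v\<in>L2_controls t T. cost lam T F FT x t v)"

definition optimal_control ::
  "real \<Rightarrow> real \<Rightarrow> ('a \<Rightarrow> real) \<Rightarrow> ('a \<Rightarrow> real) \<Rightarrow> 'a \<Rightarrow> real \<Rightarrow> (real \<Rightarrow> 'a::{real_inner, banach}) \<Rightarrow> bool"
where
  "optimal_control lam T F FT x t u \<longleftrightarrow>
     u \<in> L2_controls t T \<and>
     (\<forall>v \<in> L2_controls t T. cost lam T F FT x t u \<le> cost lam T F FT x t v)"

text \<open>
  \<open>U\<close> is \<open>C\<^sup>1\<close> on \<open>H \<times> [0,T]\<close> with gradient \<open>DU\<close> in the space variable and time derivative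
  \<open>dU\<close>, which is one-sided at \<open>0\<close> and \<open>T\<close>. The lemma below shows that this is continuous
  Frechet differentiability in both variables jointly.
\<close>

definition C1_on_strip ::
  "real \<Rightarrow> ('a::real_inner \<Rightarrow> real \<Rightarrow> real) \<Rightarrow> ('a \<Rightarrow> real \<Rightarrow> 'a) \<Rightarrow> ('a \<Rightarrow> real \<Rightarrow> real) \<Rightarrow> bool"
where
  "C1_on_strip T U DU dU \<longleftrightarrow>
     (\<forall>x. \<forall>t\<in>{0..T}. GDERIV (\<lambda>y. U y t) x :> DU x t) \<and>
     (\<forall>x. \<forall>t\<in>{0..T}. ((\<lambda>s. U x s) has_real_derivative dU x t) (at t within {0..T})) \<and>
     continuous_on (UNIV \<times> {0..T}) (\<lambda>(x, t). DU x t) \<and>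
     continuous_on (UNIV \<times> {0..T}) (\<lambda>(x, t). dU x t)"

lemma C1_on_strip_iff_has_derivative:
  "C1_on_strip T U DU dU \<longleftrightarrow>
     (\<forall>x. \<forall>t\<in>{0..T}. ((\<lambda>(y, s). U y s) has_derivative (\<lambda>(h, r). inner h (DU x t) + r * dU x t))
        (at (x, t) within UNIV \<times> {0..T})) \<and>
     continuous_on (UNIV \<times> {0..T}) (\<lambda>(x, t). DU x t) \<and>
     continuous_on (UNIV \<times> {0..T}) (\<lambda>(x, t). dU x t)"
    (is "_ \<longleftrightarrow> ?D \<and> ?c1 \<and> ?c2")
proof
  assume C: "C1_on_strip T U DU dU"
  then have c: ?c1 ?c2 by (auto simp: C1_on_strip_def)
  have "((\<lambda>(y, s). U y s) has_derivative (\<lambda>(h, r). inner h (DU x t) + r * dU x t))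
        (at (x, t) within UNIV \<times> {0..T})" if t: "t \<in> {0..T}" for x t
  proof -
    have "((\<lambda>(y, s). U y s) has_derivative
        (\<lambda>(h, r). inner h (DU x t) + blinfun_apply (blinfun_scaleR_left (dU x t)) r))
        (at (x, t) within UNIV \<times> {0..T})"
    proof (rule has_derivative_partialsI)
      show "((\<lambda>y. U y t) has_derivative (\<lambda>h. inner h (DU x t))) (at x within UNIV)"
        using C t by (auto simp: C1_on_strip_def gderiv_def)
      show "((\<lambda>s. U y s) has_derivative blinfun_apply (blinfun_scaleR_left (dU y s)))
          (at s within {0..T})" if "s \<in> {0..T}" for y s
      proof -
        have "blinfun_apply (blinfun_scaleR_left (dU y s)) = (*) (dU y s)"
          by (simp add: fun_eq_iff mult.commute)
        with C that show ?thesis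
          by (simp add: C1_on_strip_def has_field_derivative_def)
      qed
      have "continuous_on (UNIV \<times> {0..T}) (\<lambda>p. blinfun_scaleR_left ((\<lambda>(x, t). dU x t) p))"
        by (intro continuous_intros c(2))
      then show "continuous (at (x, t) within UNIV \<times> {0..T})
          (\<lambda>(x, t). blinfun_scaleR_left (dU x t))"
        using t by (auto simp: continuous_on_eq_continuous_within split_beta')
    qed (use t in auto)
    then show ?thesis by simp
  qed
  with c show "?D \<and> ?c1 \<and> ?c2" by blast
next
  assume A: "?D \<and> ?c1 \<and> ?c2"
  have "GDERIV (\<lambda>y. U y t) x :> DU x t" if t: "t \<in> {0..T}" for x t
  proof -
    have "((\<lambda>(y, s). U y s) has_derivative (\<lambda>(h, r). inner h (DU x t) + r * dU x t))
        (at (x, t) within (\<lambda>y. (y, t)) ` UNIV)"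
      using A t by (blast intro: has_derivative_subset)
    moreover have "((\<lambda>y. (y, t)) has_derivative (\<lambda>h. (h, 0))) (at x)"
      by (auto intro!: derivative_eq_intros)
    ultimately have "((\<lambda>(y, s). U y s) \<circ> (\<lambda>y. (y, t)) has_derivative
        (\<lambda>(h, r). inner h (DU x t) + r * dU x t) \<circ> (\<lambda>h. (h, 0))) (at x)"
      by (intro diff_chain_within) auto
    then show ?thesis by (simp add: gderiv_def o_def)
  qed
  moreover have "((\<lambda>s. U x s) has_real_derivative dU x t) (at t within {0..T})"
    if t: "t \<in> {0..T}" for x t
  proof -
    have "((\<lambda>(y, s). U y s) has_derivative (\<lambda>(h, r). inner h (DU x t) + r * dU x t))
        (at (x, t) within (\<lambda>s. (x, s)) ` {0..T})"
      using A t by (blast intro: has_derivative_subset)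
    moreover have "((\<lambda>s. (x, s)) has_derivative (\<lambda>r. (0, r))) (at t within {0..T})"
      by (auto intro!: derivative_eq_intros)
    ultimately have "((\<lambda>(y, s). U y s) \<circ> (\<lambda>s. (x, s)) has_derivative
        (\<lambda>(h, r). inner h (DU x t) + r * dU x t) \<circ> (\<lambda>r. (0, r))) (at t within {0..T})"
      by (intro diff_chain_within) auto
    moreover have "(\<lambda>r. r * dU x t) = (*) (dU x t)"
      by (simp add: fun_eq_iff mult.commute)
    ultimately show ?thesis by (simp add: has_field_derivative_def o_def)
  qed
  ultimately show "C1_on_strip T U DU dU" using A by (simp add: C1_on_strip_def)
qed

definition growth_bounds ::
  "real \<Rightarrow> ('a::real_inner \<Rightarrow> real \<Rightarrow> real) \<Rightarrow> ('a \<Rightarrow> real \<Rightarrow> 'a) \<Rightarrow> ('a \<Rightarrow> real \<Rightarrow> real) \<Rightarrow> bool"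
where
  "growth_bounds T U DU dU \<longleftrightarrow>
     (\<exists>C. \<forall>x. \<forall>t\<in>{0..T}.
        \<bar>U x t\<bar> \<le> C * (1 + (norm x)\<^sup>2) \<and>
        norm (DU x t) \<le> C * (1 + norm x) \<and>
        \<bar>dU x t\<bar> \<le> C * (1 + (norm x)\<^sup>2))"

definition lipschitz_bounds ::
  "real \<Rightarrow> ('a::real_inner \<Rightarrow> real \<Rightarrow> 'a) \<Rightarrow> ('a \<Rightarrow> real \<Rightarrow> real) \<Rightarrow> bool"
where
  "lipschitz_bounds T DU dU \<longleftrightarrow>
     (\<exists>C. \<forall>x1 x2. \<forall>t1\<in>{0..T}. \<forall>t2\<in>{0..T}.
        norm (DU x1 t1 - DU x2 t2)
          \<le> C * norm (x1 - x2) + C * \<bar>t1 - t2\<bar> * (1 + norm x1 + norm x2) \<and>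
        \<bar>dU x1 t1 - dU x2 t2\<bar>
          \<le> C * norm (x1 - x2) * (1 + norm x1 + norm x2)
            + C * \<bar>t1 - t2\<bar> * (1 + (norm x1)\<^sup>2 + (norm x2)\<^sup>2))"

definition bellman_solution ::
  "real \<Rightarrow> real \<Rightarrow> ('a \<Rightarrow> real) \<Rightarrow> ('a \<Rightarrow> real) \<Rightarrow>
   ('a::real_inner \<Rightarrow> real \<Rightarrow> real) \<Rightarrow> ('a \<Rightarrow> real \<Rightarrow> 'a) \<Rightarrow> ('a \<Rightarrow> real \<Rightarrow> real) \<Rightarrow> bool"
where
  "bellman_solution lam T F FT U DU dU \<longleftrightarrow>
     (\<forall>x. \<forall>t\<in>{0..T}. dU x t - 1 / (2 * lam) * (norm (DU x t))\<^sup>2 + F x = 0) \<and>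
     (\<forall>x. U x T = FT x)"

end

theory Submission
  imports Defs
begin

text \<open>
  All properties of the value function are read off from the solutions of the first order
  optimality conditions. Call \<open>X\<close> an extremal from \<open>(x, t)\<close>
  if, with the costate \<open>Z(s) = DF\<^sub>T(X(T)) + \<integral>\<^sub>s\<^sup>T DF(X(r)) dr\<close>, it satisfies
  \<open>X(s) = x - (1/\<lambda>) \<integral>\<^sub>t\<^sup>s Z(r) dr\<close>. The right hand side is Lipschitz in \<open>X\<close> for the supremum norm with
  constant \<open>q = c T (1 + T) / \<lambda> < 1\<close>. Hence extremals exist (\<open>extremal_exists\<close>), depend on \<open>x\<close> with
  Lipschitz constant \<open>1 / (1 - q)\<close> (\<open>extremal_lipschitz\<close>) and grow linearly in \<open>x\<close>
  (\<open>extremal_bound\<close>).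

  The control \<open>u = - Z / \<lambda>\<close> of an extremal is optimal, and uniquely so. For another control \<open>u + h\<close>,
  whose state is \<open>X + Y\<close> with \<open>Y' = h\<close>, integration by parts shows that the terms of the cost that are
  linear in \<open>h\<close> cancel. The quadratic term \<open>\<lambda>/2 \<integral>\<parallel>h\<parallel>\<^sup>2\<close> dominates the possible concavity of \<open>F\<close>
  and \<open>F\<^sub>T\<close>, because \<open>\<parallel>Y(s)\<parallel>\<^sup>2 \<le> T \<integral>\<parallel>h\<parallel>\<^sup>2\<close>. So the cost exceeds that of \<open>u\<close> by at least
  \<open>(\<lambda> - c T (1 + T)) / 2 * \<integral>\<parallel>h\<parallel>\<^sup>2\<close> (\<open>cost_quadratic_growth\<close>).

  Therefore \<open>V(x, t)\<close> is the cost of the extremal control. Using the control of the extremal from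
  \<open>(x, t)\<close> at the initial state \<open>y\<close>, and conversely, gives
  \<open>V(y, t) = V(x, t) + Z(t) \<bullet> (y - x) + O(\<parallel>y - x\<parallel>\<^sup>2)\<close>, that is \<open>D\<^sub>XV(x, t) = Z(t)\<close>
  (\<open>value_function_gradient_estimate\<close>). An extremal restricted to a later time interval is again an
  extremal, so \<open>Z(s) = D\<^sub>XV(X(s), s)\<close> and the dynamic programming identity holds along \<open>X\<close>. Together
  with the gradient estimate it yields an expansion of \<open>V(x, \<cdot>)\<close> with quadratic error
  (\<open>value_function_forward_estimate\<close>) whose slope is the time derivative that the Bellman equation
  prescribes. The growth and Lipschitz bounds follow from those for extremals.

  Uniqueness for the Bellman equation is a verification argument (\<open>verification\<close>): if \<open>W\<close> solves it,
  completing the square gives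
  \<open>J(v) = W(x, t) + \<lambda>/2 \<integral>\<parallel>v(s) + D\<^sub>XW(X(s), s) / \<lambda>\<parallel>\<^sup>2 ds\<close> for continuous controls \<open>v\<close>. The extremal
  control gives \<open>W \<le> V\<close>. The closed loop equation \<open>X' = - D\<^sub>XW(X, s) / \<lambda>\<close> is solvable because of the
  Lipschitz bound on \<open>D\<^sub>XW\<close>, and its solution makes the square vanish, so \<open>V \<le> W\<close>.
\<close>

section \<open>Strongly measurable functions with values in a Banach space\<close>

text \<open>
  The exceptional null set is harmless because the Lebesgue measure is complete.
\<close>

lemma borel_measurable_AE_limit:
  fixes g :: "nat \<Rightarrow> real \<Rightarrow> real"
  assumes g: "\<And>n. g n \<in> borel_measurable (lebesgue_on S)"
    and lim: "AE x in lebesgue_on S. (\<lambda>n. g n x) \<longlonglongrightarrow> f x"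
    and S: "S \<in> sets lebesgue"
  shows "f \<in> borel_measurable (lebesgue_on S)"
proof -
  define l where "l x = lim (\<lambda>n. g n x)" for x
  have l: "l \<in> borel_measurable (lebesgue_on S)"
    unfolding l_def using g by measurable
  have "AE x in lebesgue_on S. l x = f x"
    using lim by eventually_elim (simp add: l_def limI)
  then have "AE x in lebesgue. (if x \<in> S then l x else 0) = (if x \<in> S then f x else 0)"
    using S by (auto simp: AE_restrict_space_iff elim: eventually_mono)
  moreover have "(\<lambda>x. if x \<in> S then l x else 0) \<in> borel_measurable lebesgue"
    by (rule borel_measurable_if_I[OF l S])
  ultimately have "(\<lambda>x. if x \<in> S then f x else 0) \<in> borel_measurable lebesgue"
    by (rule borel_measurable_AE[rotated])
  then show ?thesis
    using S by (simp add: borel_measurable_if)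
qed

lemma strongly_measurable_diff:
  fixes f g :: "'b \<Rightarrow> 'a::real_normed_vector"
  assumes "strongly_measurable M f" "strongly_measurable M g"
  shows "strongly_measurable M (\<lambda>x. f x - g x)"
proof -
  obtain F where F: "\<And>n. simple_function M (F n)" "AE x in M. (\<lambda>n. F n x) \<longlonglongrightarrow> f x"
    using assms(1) unfolding strongly_measurable_def by blast
  obtain G where G: "\<And>n. simple_function M (G n)" "AE x in M. (\<lambda>n. G n x) \<longlonglongrightarrow> g x"
    using assms(2) unfolding strongly_measurable_def by blast
  have "simple_function M (\<lambda>x. F n x - G n x)" for n
    using F(1) G(1) by (rule simple_function_compose2)
  moreover have "AE x in M. (\<lambda>n. F n x - G n x) \<longlonglongrightarrow> f x - g x"
    using F(2) G(2) by eventually_elim (rule tendsto_diff)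
  ultimately show ?thesis
    unfolding strongly_measurable_def by (intro exI[of _ "\<lambda>n x. F n x - G n x"]) auto
qed

lemma strongly_measurable_norm:
  fixes f :: "real \<Rightarrow> 'a::real_normed_vector"
  assumes "strongly_measurable (lebesgue_on S) f" "S \<in> sets lebesgue"
  shows "(\<lambda>x. norm (f x)) \<in> borel_measurable (lebesgue_on S)"
proof -
  obtain G where G: "\<And>n. simple_function (lebesgue_on S) (G n)"
      "AE x in lebesgue_on S. (\<lambda>n. G n x) \<longlonglongrightarrow> f x"
    using assms(1) unfolding strongly_measurable_def by blast
  show ?thesis
  proof (rule borel_measurable_AE_limit[OF _ _ assms(2)])
    show "(\<lambda>x. norm (G n x)) \<in> borel_measurable (lebesgue_on S)" for n
      using G(1) by (intro borel_measurable_simple_function) (rule simple_function_compose1)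
    show "AE x in lebesgue_on S. (\<lambda>n. norm (G n x)) \<longlonglongrightarrow> norm (f x)"
      using G(2) by eventually_elim (rule tendsto_norm)
  qed
qed

lemma simple_function_strongly_measurable:
  "simple_function M g \<Longrightarrow> strongly_measurable M g"
  unfolding strongly_measurable_def by (intro exI[of _ "\<lambda>_. g"]) auto

lemma simple_function_integrable_on:
  fixes g :: "real \<Rightarrow> 'a::banach"
  assumes g: "simple_function (lebesgue_on {a..b}) g"
  shows "g integrable_on {a..b}"
proof -
  let ?A = "\<lambda>y. g -` {y} \<inter> {a..b}"
  have fin: "finite (g ` {a..b})" and meas: "\<And>y. ?A y \<in> sets (lebesgue_on {a..b})"
    using simple_functionD[OF g] by auto
  have "(\<lambda>x. \<Sum>y\<in>g ` {a..b}. indicat_real (?A y) x *\<^sub>R y) integrable_on {a..b}"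
  proof (intro integrable_sum fin integrable_on_scaleR_left)
    fix y
    have "?A y \<in> lmeasurable"
      by (rule bounded_set_imp_lmeasurable)
        (use meas in \<open>auto simp: sets_restrict_space_iff intro: bounded_subset[of "{a..b}"]\<close>)
    moreover have "?A y \<inter> {a..b} = ?A y" by blast
    ultimately show "indicat_real (?A y) integrable_on {a..b}"
      by (simp only: integrable_on_indicator)
  qed
  moreover have "(\<Sum>y\<in>g ` {a..b}. indicat_real (?A y) x *\<^sub>R y) = g x" if "x \<in> {a..b}" for x
  proof -
    have "(\<Sum>y\<in>g ` {a..b}. indicat_real (?A y) x *\<^sub>R y) = (\<Sum>y\<in>g ` {a..b}. if y = g x then y else 0)"
      by (rule sum.cong) (use that in \<open>auto simp: indicator_def\<close>)
    then show ?thesis using fin that by simp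
  qed
  ultimately show ?thesis
    using integrable_cong[of "{a..b}" "\<lambda>x. \<Sum>y\<in>g ` {a..b}. indicat_real (?A y) x *\<^sub>R y" g] by auto
qed

text \<open>
  The Riemann sums of \<open>f\<close> differ from those of \<open>g\<close> by at most the Riemann sums of the real function
  \<open>norm (f s - g s)\<close>, which are close to its integral. So the Cauchy criterion for \<open>g\<close> passes to \<open>f\<close>.
  Only norms enter, so the range of \<open>f\<close> may be nonseparable.
\<close>

lemma integrable_on_L1_approx:
  fixes f :: "real \<Rightarrow> 'a::banach"
  assumes approx: "\<And>e. e > 0 \<Longrightarrow> \<exists>g. g integrable_on {a..b} \<and>
      (\<lambda>s. norm (f s - g s)) integrable_on {a..b} \<and> integral {a..b} (\<lambda>s. norm (f s - g s)) < e"
  shows "f integrable_on {a..b}"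
proof -
  have "\<exists>\<gamma>. gauge \<gamma> \<and>
     (\<forall>\<D>1 \<D>2. \<D>1 tagged_division_of (cbox a b) \<and> \<gamma> fine \<D>1 \<and>
            \<D>2 tagged_division_of (cbox a b) \<and> \<gamma> fine \<D>2 \<longrightarrow>
            norm ((\<Sum>(x,K)\<in>\<D>1. measure lborel K *\<^sub>R f x) - (\<Sum>(x,K)\<in>\<D>2. measure lborel K *\<^sub>R f x)) < e)"
    if "e > 0" for e
  proof -
    obtain g where g: "g integrable_on cbox a b"
      and d: "(\<lambda>s. norm (f s - g s)) integrable_on cbox a b"
      and small: "integral (cbox a b) (\<lambda>s. norm (f s - g s)) < e / 8"
      using approx[of "e / 8"] \<open>e > 0\<close> by auto
    obtain \<gamma>1 where \<gamma>1: "gauge \<gamma>1" "\<And>\<D>. \<D> tagged_division_of cbox a b \<Longrightarrow> \<gamma>1 fine \<D> \<Longrightarrow>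
        norm ((\<Sum>(x,K)\<in>\<D>. measure lborel K *\<^sub>R g x) - integral (cbox a b) g) < e / 8"
      using g[THEN integrable_integral, unfolded has_integral, rule_format, of "e / 8"] \<open>e > 0\<close>
      by auto
    obtain \<gamma>2 where \<gamma>2: "gauge \<gamma>2" "\<And>\<D>. \<D> tagged_division_of cbox a b \<Longrightarrow> \<gamma>2 fine \<D> \<Longrightarrow>
        norm ((\<Sum>(x,K)\<in>\<D>. measure lborel K *\<^sub>R norm (f x - g x))
              - integral (cbox a b) (\<lambda>s. norm (f s - g s))) < e / 8"
      using d[THEN integrable_integral, unfolded has_integral, rule_format, of "e / 8"] \<open>e > 0\<close>
      by auto
    define I where "I = integral (cbox a b) g"
    have key: "norm ((\<Sum>(x,K)\<in>\<D>. measure lborel K *\<^sub>R f x) - I) < 3 * e / 8"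
      if D: "\<D> tagged_division_of cbox a b" "\<gamma>1 fine \<D>" "\<gamma>2 fine \<D>" for \<D>
    proof -
      have "(\<Sum>(x,K)\<in>\<D>. measure lborel K *\<^sub>R f x) - (\<Sum>(x,K)\<in>\<D>. measure lborel K *\<^sub>R g x)
          = (\<Sum>(x,K)\<in>\<D>. measure lborel K *\<^sub>R (f x - g x))"
        by (simp add: sum_subtractf[symmetric] split_def scaleR_diff_right)
      also have "norm \<dots> \<le> (\<Sum>(x,K)\<in>\<D>. measure lborel K *\<^sub>R norm (f x - g x))"
        by (rule sum_norm_le) (auto simp: split_def)
      also have "\<dots> < e / 4"
      proof -
        have "S < e / 4" if "norm (S - J) < e / 8" "J < e / 8" for S J :: real
          using that unfolding real_norm_def by linarith
        from this[OF \<gamma>2(2)[OF D(1,3)] small] show ?thesis .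
      qed
      finally show ?thesis
        by (rule order.strict_trans1[OF norm_diff_triangle_le[OF order_refl order_refl] add_strict_mono,
              OF _ \<gamma>1(2)[OF D(1,2), folded I_def], THEN order.strict_trans2]) simp
    qed
    show ?thesis
    proof (intro exI[of _ "\<lambda>x. \<gamma>1 x \<inter> \<gamma>2 x"] conjI allI impI)
      show "gauge (\<lambda>x. \<gamma>1 x \<inter> \<gamma>2 x)" using \<gamma>1 \<gamma>2 by (intro gauge_Int)
      fix \<D>1 \<D>2
      assume A: "\<D>1 tagged_division_of (cbox a b) \<and> (\<lambda>x. \<gamma>1 x \<inter> \<gamma>2 x) fine \<D>1 \<and>
            \<D>2 tagged_division_of (cbox a b) \<and> (\<lambda>x. \<gamma>1 x \<inter> \<gamma>2 x) fine \<D>2"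
      have "norm (x - y) < e" if "norm (x - I) < 3 * e / 8" "norm (y - I) < 3 * e / 8" for x y
        using norm_triangle_ineq4[of "x - I" "y - I"] that \<open>e > 0\<close> by simp
      from this[OF key key]
      show "norm ((\<Sum>(x,K)\<in>\<D>1. measure lborel K *\<^sub>R f x) - (\<Sum>(x,K)\<in>\<D>2. measure lborel K *\<^sub>R f x)) < e"
        using A by (simp add: fine_Int)
    qed
  qed
  then show ?thesis
    using integrable_Cauchy[of f a b] by (simp add: cbox_interval)
qed

text \<open>
  Strong measurability gives pointwise limits of simple functions only. Truncating them at twice the
  norm of the limit makes dominated convergence applicable to the norm of the difference, and turns
  pointwise approximation into approximation in \<open>L\<^sup>1\<close>.
\<close>

lemma strongly_measurable_integrable_on:
  fixes f :: "real \<Rightarrow> 'a::banach"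
  assumes f: "strongly_measurable (lebesgue_on {a..b}) f"
    and int: "integrable (lebesgue_on {a..b}) (\<lambda>s. norm (f s))"
  shows "f integrable_on {a..b}"
proof -
  let ?M = "lebesgue_on {a..b}"
  obtain G where G: "\<And>n. simple_function ?M (G n)"
      "AE x in ?M. (\<lambda>n. G n x) \<longlonglongrightarrow> f x"
    using f unfolding strongly_measurable_def by blast
  \<comment> \<open>The factor 2 keeps the truncation inactive in the limit wherever the limit is nonzero.\<close>
  define g where "g n x = (if norm (G n x) \<le> 2 * norm (f x) then G n x else 0)" for n x
  have nG: "(\<lambda>x. norm (G n x)) \<in> borel_measurable ?M" for n
    using G(1) by (intro borel_measurable_simple_function) (rule simple_function_compose1)
  have g: "simple_function ?M (g n)" for n
    unfolding g_def
  proof (intro simple_function_If G simple_function_const)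
    show "{x \<in> space ?M. norm (G n x) \<le> 2 * norm (f x)} \<in> sets ?M"
      by (intro borel_measurable_le borel_measurable_times borel_measurable_const nG
          borel_measurable_integrable[OF int])
  qed
  have lim: "AE x in ?M. (\<lambda>n. norm (f x - g n x)) \<longlonglongrightarrow> 0"
    using G(2)
  proof eventually_elim
    fix x assume x: "(\<lambda>n. G n x) \<longlonglongrightarrow> f x"
    have "(\<lambda>n. g n x) \<longlonglongrightarrow> f x"
    proof (cases "f x = 0")
      case True
      then have "(\<lambda>n. g n x) = (\<lambda>n. 0)" by (auto simp: g_def)
      then show ?thesis using True by simp
    next
      case False
      have "(\<lambda>n. norm (G n x)) \<longlonglongrightarrow> norm (f x)" using x by (rule tendsto_norm)
      then have "eventually (\<lambda>n. norm (G n x) < 2 * norm (f x)) sequentially"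
        using False by (intro order_tendstoD(2)) auto
      then have "eventually (\<lambda>n. G n x = g n x) sequentially"
        by eventually_elim (simp add: g_def)
      with x show ?thesis by (rule Lim_transform_eventually)
    qed
    then have "(\<lambda>n. f x - g n x) \<longlonglongrightarrow> f x - f x" by (intro tendsto_intros)
    then show "(\<lambda>n. norm (f x - g n x)) \<longlonglongrightarrow> 0" by (auto dest: tendsto_norm_zero)
  qed
  have meas: "(\<lambda>x. norm (f x - g n x)) \<in> borel_measurable ?M" for n
    by (intro strongly_measurable_norm strongly_measurable_diff f
        simple_function_strongly_measurable g) simp
  have bound: "AE x in ?M. norm (norm (f x - g n x)) \<le> 3 * norm (f x)" for n
  proof (rule AE_I2)
    fix x
    have "norm (g n x) \<le> 2 * norm (f x)" by (simp add: g_def)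
    then show "norm (norm (f x - g n x)) \<le> 3 * norm (f x)"
      using norm_triangle_ineq4[of "f x" "g n x"] by simp
  qed
  have int3: "integrable ?M (\<lambda>x. 3 * norm (f x))" using int by simp
  have dc: "integrable ?M (\<lambda>x. norm (f x - g n x))"
    "(\<lambda>n. LINT x|?M. norm (f x - g n x)) \<longlonglongrightarrow> (LINT x|?M. 0)" for n
    using integral_dominated_convergence[OF _ meas int3 lim bound]
      integrable_dominated_convergence2[OF _ meas int3 lim bound] by auto
  show ?thesis
  proof (rule integrable_on_L1_approx)
    fix e :: real assume "e > 0"
    then have "eventually (\<lambda>n. (LINT x|?M. norm (f x - g n x)) < e) sequentially"
      using dc(2) by (intro order_tendstoD(2)) auto
    then obtain n where n: "(LINT x|?M. norm (f x - g n x)) < e"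
      by (auto simp: eventually_sequentially)
    then show "\<exists>g. g integrable_on {a..b} \<and>
      (\<lambda>s. norm (f s - g s)) integrable_on {a..b} \<and> integral {a..b} (\<lambda>s. norm (f s - g s)) < e"
      using dc(1)[of n] simple_function_integrable_on[OF g]
      by (intro exI[of _ "g n"]) (auto simp: integrable_on_lebesgue_on lebesgue_integral_eq_integral)
  qed
qed

text \<open>
  The approximating simple functions evaluate \<open>u\<close> at the nearest grid point of mesh \<open>1 / (n + 1)\<close> to
  the left. The maximum with \<open>a\<close> keeps that point in the domain of continuity.
\<close>

lemma continuous_on_strongly_measurable:
  fixes u :: "real \<Rightarrow> 'a::real_normed_vector"
  assumes u: "continuous_on {a..b} u"
  shows "strongly_measurable (lebesgue_on {a..b}) u"
proof -
  define k where "k n s = max a (of_int \<lfloor>real (Suc n) * s\<rfloor> / real (Suc n))" for n and s :: real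
  have k_ge: "a \<le> k n s" for n s by (simp add: k_def)
  have fl: "real_of_int \<lfloor>real (Suc n) * s\<rfloor> / real (Suc n) \<le> s"
    "s - 1 / real (Suc n) \<le> real_of_int \<lfloor>real (Suc n) * s\<rfloor> / real (Suc n)" for n s
  proof -
    show "real_of_int \<lfloor>real (Suc n) * s\<rfloor> / real (Suc n) \<le> s"
      by (simp add: divide_le_eq mult.commute del: of_nat_Suc)
    have "(real (Suc n) * s - 1) / real (Suc n) \<le> real_of_int \<lfloor>real (Suc n) * s\<rfloor> / real (Suc n)"
      by (rule divide_right_mono) linarith+
    then show "s - 1 / real (Suc n) \<le> real_of_int \<lfloor>real (Suc n) * s\<rfloor> / real (Suc n)"
      by (simp add: diff_divide_distrib del: of_nat_Suc)
  qed
  have simple: "simple_function (lebesgue_on {a..b}) (\<lambda>s. u (k n s))" for n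
  proof (rule simple_function_compose1[of _ "k n"], rule simple_function_borel_measurable)
    have "k n \<in> borel_measurable borel"
      unfolding k_def by measurable
    then show "k n \<in> borel_measurable (lebesgue_on {a..b})"
      by (simp add: borel_measurable_restrict_space_iff measurable_completion measurable_restrict_space1)
    have "k n ` {a..b} \<subseteq> (\<lambda>i. max a (of_int i / real (Suc n))) `
        {\<lfloor>real (Suc n) * a\<rfloor>..\<lfloor>real (Suc n) * b\<rfloor>}"
      unfolding k_def by (auto intro!: imageI floor_mono mult_left_mono simp del: of_nat_Suc)
    then show "finite (k n ` space (lebesgue_on {a..b}))"
      unfolding space_lebesgue_on by (rule finite_subset) simp
  qed
  have "(\<lambda>n. u (k n s)) \<longlonglongrightarrow> u s" if s: "s \<in> {a..b}" for s
  proof (rule continuous_on_tendsto_compose[OF u])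
    show "s \<in> {a..b}" by fact
    show "eventually (\<lambda>n. k n s \<in> {a..b}) sequentially"
    proof (rule always_eventually, rule allI)
      fix n show "k n s \<in> {a..b}"
        using k_ge[of n s] fl(1)[where n = n and s = s] s unfolding k_def by auto
    qed
    show "(\<lambda>n. k n s) \<longlonglongrightarrow> s"
    proof (rule tendsto_sandwich[of "\<lambda>n. s - 1 / real (Suc n)" _ _ "\<lambda>n. s"])
      show "(\<lambda>n. s - 1 / real (Suc n)) \<longlonglongrightarrow> s"
        using tendsto_diff[OF tendsto_const LIMSEQ_inverse_real_of_nat, of s]
        by (simp add: inverse_eq_divide)
    next
      show "\<forall>\<^sub>F n in sequentially. s - 1 / real (Suc n) \<le> k n s"
        using fl(2)[where s = s] by (auto simp: k_def le_max_iff_disj simp del: of_nat_Suc)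
      show "\<forall>\<^sub>F n in sequentially. k n s \<le> s"
        using fl(1)[where s = s] s by (auto simp: k_def simp del: of_nat_Suc)
    qed simp
  qed
  then show ?thesis
    unfolding strongly_measurable_def
    by (intro exI[of _ "\<lambda>n s. u (k n s)"]) (auto intro!: simple AE_I2)
qed

section \<open>Square integrable controls\<close>

lemma L2_controls_norm_integrable:
  assumes v: "v \<in> L2_controls t T"
  shows "integrable (lebesgue_on {t..T}) (\<lambda>s. norm (v s))"
proof (rule Bochner_Integration.integrable_bound)
  show "integrable (lebesgue_on {t..T}) (\<lambda>s. 1 + (norm (v s))\<^sup>2)"
    using v by (auto simp: L2_controls_def intro!: Bochner_Integration.integrable_add
        continuous_imp_integrable_real)
  show "(\<lambda>s. norm (v s)) \<in> borel_measurable (lebesgue_on {t..T})"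
    using v by (intro strongly_measurable_norm) (auto simp: L2_controls_def)
  have "norm (v s) \<le> 1 + (norm (v s))\<^sup>2" for s
  proof -
    have "0 \<le> (norm (v s) - 1)\<^sup>2" by simp
    then have "2 * norm (v s) \<le> 1 + (norm (v s))\<^sup>2" by (simp add: power2_diff)
    then show ?thesis using norm_ge_zero[of "v s"] by linarith
  qed
  then show "AE s in lebesgue_on {t..T}. norm (norm (v s)) \<le> norm (1 + (norm (v s))\<^sup>2)"
    by (auto intro!: AE_I2)
qed

lemma L2_controls_integrable_on:
  assumes v: "v \<in> L2_controls t T"
  shows "v integrable_on {t..T}" "(\<lambda>s. norm (v s)) integrable_on {t..T}"
    "(\<lambda>s. (norm (v s))\<^sup>2) integrable_on {t..T}"
    "(LINT s|lebesgue_on {t..T}. (norm (v s))\<^sup>2) = integral {t..T} (\<lambda>s. (norm (v s))\<^sup>2)"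
proof -
  show "v integrable_on {t..T}" "(\<lambda>s. norm (v s)) integrable_on {t..T}"
    using v L2_controls_norm_integrable[OF v]
    by (auto simp: L2_controls_def intro: strongly_measurable_integrable_on integrable_on_lebesgue_on)
  show "(\<lambda>s. (norm (v s))\<^sup>2) integrable_on {t..T}"
    "(LINT s|lebesgue_on {t..T}. (norm (v s))\<^sup>2) = integral {t..T} (\<lambda>s. (norm (v s))\<^sup>2)"
    using v by (auto simp: L2_controls_def integrable_on_lebesgue_on lebesgue_integral_eq_integral)
qed

lemma continuous_on_L2_controls:
  assumes "continuous_on {t..T} u"
  shows "u \<in> L2_controls t T"
  using assms by (auto simp: L2_controls_def
      intro!: continuous_on_strongly_measurable continuous_imp_integrable_real continuous_intros)

lemma L2_controls_diff:
  assumes u: "u \<in> L2_controls t T" and v: "v \<in> L2_controls t T"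
  shows "(\<lambda>s. v s - u s) \<in> L2_controls t T"
proof -
  have sm: "strongly_measurable (lebesgue_on {t..T}) (\<lambda>s. v s - u s)"
    using u v by (intro strongly_measurable_diff) (auto simp: L2_controls_def)
  have "integrable (lebesgue_on {t..T}) (\<lambda>s. (norm (v s - u s))\<^sup>2)"
  proof (rule Bochner_Integration.integrable_bound)
    show "integrable (lebesgue_on {t..T}) (\<lambda>s. 2 * (norm (v s))\<^sup>2 + 2 * (norm (u s))\<^sup>2)"
      using u v by (auto simp: L2_controls_def)
    show "(\<lambda>s. (norm (v s - u s))\<^sup>2) \<in> borel_measurable (lebesgue_on {t..T})"
      using strongly_measurable_norm[OF sm] by (intro borel_measurable_power) auto
    have "(norm (v s - u s))\<^sup>2 \<le> 2 * (norm (v s))\<^sup>2 + 2 * (norm (u s))\<^sup>2" for s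
    proof -
      have "0 \<le> (norm (v s + u s))\<^sup>2" by simp
      then show ?thesis
        by (simp add: power2_norm_eq_inner algebra_simps inner_commute)
    qed
    then show "AE s in lebesgue_on {t..T}.
        norm ((norm (v s - u s))\<^sup>2) \<le> norm (2 * (norm (v s))\<^sup>2 + 2 * (norm (u s))\<^sup>2)"
      by (auto intro!: AE_I2)
  qed
  with sm show ?thesis by (simp add: L2_controls_def)
qed

section \<open>Integral inequalities and integration by parts\<close>

lemma integral_subinterval:
  fixes f :: "real \<Rightarrow> 'a::banach"
  assumes "f integrable_on {a..b}" "a \<le> s" "s \<le> s'" "s' \<le> b"
  shows "f integrable_on {s..s'}" "integral {a..s'} f - integral {a..s} f = integral {s..s'} f"
    "integral {s..b} f - integral {s'..b} f = integral {s..s'} f"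
proof -
  have sub: "f integrable_on {c..d}" if "a \<le> c" "d \<le> b" for c d
    by (rule integrable_subinterval_real[OF assms(1)]) (use that in auto)
  show "f integrable_on {s..s'}" using assms by (intro sub) auto
  show "integral {a..s'} f - integral {a..s} f = integral {s..s'} f"
    using Henstock_Kurzweil_Integration.integral_combine[OF assms(2,3), of f] sub[of a s'] assms by (simp add: algebra_simps)
  show "integral {s..b} f - integral {s'..b} f = integral {s..s'} f"
    using Henstock_Kurzweil_Integration.integral_combine[OF assms(3,4), of f] sub[of s b] assms by (simp add: algebra_simps)
qed

lemma integral_norm_le_const:
  fixes f :: "real \<Rightarrow> 'a::banach"
  assumes "f integrable_on {a..b}" "a \<le> b" "\<And>s. s \<in> {a..b} \<Longrightarrow> norm (f s) \<le> B"
  shows "norm (integral {a..b} f) \<le> B * (b - a)"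
  using integral_norm_bound_integral[OF assms(1) integrable_const_ivl, of B] assms(2,3)
  by (simp add: mult.commute)

text \<open>
  The Cauchy--Schwarz inequality against the constant 1, from the positivity of the integral of
  \<open>((b - a) f - I)\<^sup>2\<close>, where \<open>I\<close> is the integral of \<open>f\<close>.
\<close>

lemma square_integral_le:
  fixes f :: "real \<Rightarrow> real"
  assumes f: "f integrable_on {a..b}" "(\<lambda>s. (f s)\<^sup>2) integrable_on {a..b}" and "a \<le> b"
  shows "(integral {a..b} f)\<^sup>2 \<le> (b - a) * integral {a..b} (\<lambda>s. (f s)\<^sup>2)"
proof (cases "a = b")
  case False
  define I where "I = integral {a..b} f"
  have *: "((\<lambda>s. ((b - a) * f s - I)\<^sup>2) has_integral
      ((b - a)\<^sup>2 * integral {a..b} (\<lambda>s. (f s)\<^sup>2) - 2 * (b - a) * I * I + (b - a) *\<^sub>R I\<^sup>2)) {a..b}"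
    (is "(_ has_integral ?r) _")
  proof -
    have "((\<lambda>s. (b - a)\<^sup>2 * (f s)\<^sup>2 - 2 * (b - a) * I * f s + I\<^sup>2) has_integral ?r) {a..b}"
      unfolding I_def
      by (intro has_integral_add has_integral_diff has_integral_mult_right integrable_integral f
          has_integral_const_real[of _ a b, simplified] has_integral_eq_rhs[OF has_integral_const_real])
        (use \<open>a \<le> b\<close> in simp)
    then show ?thesis
      by (rule has_integral_eq[rotated]) (simp add: power2_eq_square algebra_simps)
  qed
  have "0 \<le> ?r" by (rule has_integral_nonneg[OF *]) simp
  then have "0 \<le> (b - a) * ((b - a) * integral {a..b} (\<lambda>s. (f s)\<^sup>2) - I\<^sup>2)"
    by (simp add: power2_eq_square algebra_simps)
  with False \<open>a \<le> b\<close> show ?thesis by (simp add: zero_le_mult_iff I_def)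
qed simp

text \<open>
  The increments are \<open>o(s' - s)\<close> because \<open>H\<close> is continuous, so \<open>f\<close> has derivative zero everywhere.
  This serves to prove identities between indefinite integrals of functions that are only integrable,
  whose indefinite integrals need not be differentiable everywhere.
\<close>

lemma constant_of_superlinear_increments:
  fixes f H :: "real \<Rightarrow> real"
  assumes ab: "a \<le> b" and H: "continuous_on {a..b} H"
    and bound: "\<And>s s'. a \<le> s \<Longrightarrow> s \<le> s' \<Longrightarrow> s' \<le> b \<Longrightarrow> \<bar>f s' - f s\<bar> \<le> C * (s' - s) * (H s' - H s)"
  shows "f a = f b"
proof -
  have "(f has_field_derivative 0) (at x within {a..b})" if x: "x \<in> {a..b}" for x
    unfolding has_field_derivative_iff
  proof (rule Lim_null_comparison)
    have "((\<lambda>y. \<bar>C\<bar> * \<bar>H y - H x\<bar>) \<longlongrightarrow> \<bar>C\<bar> * \<bar>H x - H x\<bar>) (at x within {a..b})"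
      using H x by (intro tendsto_intros) (auto simp: continuous_on_def)
    then show "((\<lambda>y. \<bar>C\<bar> * \<bar>H y - H x\<bar>) \<longlongrightarrow> 0) (at x within {a..b})" by simp
    show "\<forall>\<^sub>F y in at x within {a..b}. norm ((f y - f x) / (y - x)) \<le> \<bar>C\<bar> * \<bar>H y - H x\<bar>"
      unfolding eventually_at_filter
    proof (rule always_eventually, intro allI impI)
      fix y assume y: "y \<noteq> x" "y \<in> {a..b}"
      have "\<bar>f y - f x\<bar> \<le> \<bar>C\<bar> * \<bar>y - x\<bar> * \<bar>H y - H x\<bar>"
      proof (cases "x \<le> y")
        case True
        then have "\<bar>f y - f x\<bar> \<le> C * (y - x) * (H y - H x)" using bound[of x y] x y by simp
        also have "\<dots> \<le> \<bar>C * (y - x) * (H y - H x)\<bar>" by simp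
        finally show ?thesis by (simp only: abs_mult)
      next
        case False
        then have "\<bar>f x - f y\<bar> \<le> C * (x - y) * (H x - H y)" using bound[of y x] x y by simp
        also have "\<dots> \<le> \<bar>C * (x - y) * (H x - H y)\<bar>" by simp
        finally show ?thesis by (simp only: abs_mult abs_minus_commute)
      qed
      then show "norm ((f y - f x) / (y - x)) \<le> \<bar>C\<bar> * \<bar>H y - H x\<bar>"
        using y by (simp add: divide_le_eq mult_ac)
    qed
  qed
  then obtain c where "\<forall>x\<in>{a..b}. f x = c"
    using has_field_derivative_zero_constant[of "{a..b}" f] by auto
  then show ?thesis using ab by simp
qed

text \<open>
  The indefinite integral of \<open>h\<close> need not be differentiable everywhere. The difference \<open>D\<close> of the two
  sides over \<open>{a..s}\<close> is nevertheless constant in \<open>s\<close>: its increment over \<open>{s..s'}\<close> only involves the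
  variations of \<open>Z\<close> and \<open>Y\<close> there, and is at most \<open>2 M (s' - s)\<close> times the integral of \<open>norm h\<close> over
  \<open>{s..s'}\<close>.
\<close>

lemma integration_by_parts_indefinite:
  fixes p h Z :: "real \<Rightarrow> 'a::{real_inner, banach}"
  assumes ab: "a \<le> b" and p: "continuous_on {a..b} p"
    and h: "h integrable_on {a..b}" and nh: "(\<lambda>s. norm (h s)) integrable_on {a..b}"
    and Z: "\<And>s. s \<in> {a..b} \<Longrightarrow> Z s = z + integral {s..b} p"
    and Zh: "(\<lambda>s. Z s \<bullet> h s) integrable_on {a..b}"
  shows "integral {a..b} (\<lambda>s. Z s \<bullet> h s)
    = z \<bullet> integral {a..b} h + integral {a..b} (\<lambda>s. p s \<bullet> integral {a..s} h)"
proof -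
  define Y H where "Y s = integral {a..s} h" and "H s = integral {a..s} (\<lambda>r. norm (h r))" for s
  have "bounded (p ` {a..b})"
    by (intro compact_imp_bounded compact_continuous_image[OF p] compact_Icc)
  then obtain M where M: "\<And>s. s \<in> {a..b} \<Longrightarrow> norm (p s) \<le> M"
    unfolding bounded_iff by blast
  have "0 \<le> M" using order_trans[OF norm_ge_zero M[of a]] ab by simp
  have Y: "continuous_on {a..b} Y" and H: "continuous_on {a..b} H"
    unfolding Y_def H_def by (intro indefinite_integral_continuous_1 h nh)+
  have p_int: "p integrable_on {a..b}" and pY: "(\<lambda>s. p s \<bullet> Y s) integrable_on {a..b}"
    by (intro integrable_continuous_real continuous_intros p Y)+
  define D where "D s = integral {a..s} (\<lambda>r. Z r \<bullet> h r) - Z s \<bullet> Y s - integral {a..s} (\<lambda>r. p r \<bullet> Y r)" for s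
  have "D a = D b"
  proof (rule constant_of_superlinear_increments[OF ab H, of _ "2 * M"])
    fix s s' assume s: "a \<le> s" "s \<le> s'" "s' \<le> b"
    note sub = integral_subinterval[OF _ s]
    have ip: "norm (integral {c..d} p) \<le> M * (d - c)" if "a \<le> c" "c \<le> d" "d \<le> b" for c d
      using that integral_subinterval(1)[OF p_int that] M by (intro integral_norm_le_const) auto
    have Zd: "Z c - Z d = integral {c..d} p" if "a \<le> c" "c \<le> d" "d \<le> b" for c d
      using Z[of c] Z[of d] integral_subinterval(3)[OF p_int that] that by simp
    have Yd: "Y s' - Y s = integral {s..s'} h" unfolding Y_def by (rule sub(2)[OF h])
    have Hd: "H s' - H s = integral {s..s'} (\<lambda>r. norm (h r))" unfolding H_def by (rule sub(2)[OF nh])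
    have i1: "(\<lambda>r. Z s \<bullet> h r) integrable_on {s..s'}"
      and e1: "integral {s..s'} (\<lambda>r. Z s \<bullet> h r) = Z s \<bullet> integral {s..s'} h"
      using integrable_linear[OF sub(1)[OF h] bounded_linear_inner_right[of "Z s"]]
        integral_linear[OF sub(1)[OF h] bounded_linear_inner_right[of "Z s"]] by (auto simp: o_def)
    have i2: "(\<lambda>r. p r \<bullet> Y s') integrable_on {s..s'}"
      and e2: "integral {s..s'} (\<lambda>r. p r \<bullet> Y s') = integral {s..s'} p \<bullet> Y s'"
      using integrable_linear[OF sub(1)[OF p_int] bounded_linear_inner_left[of "Y s'"]]
        integral_linear[OF sub(1)[OF p_int] bounded_linear_inner_left[of "Y s'"]] by (auto simp: o_def)
    have A: "D s' - D s = integral {s..s'} (\<lambda>r. Z r \<bullet> h r - Z s \<bullet> h r)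
        - integral {s..s'} (\<lambda>r. p r \<bullet> Y r - p r \<bullet> Y s')"
      using sub(2)[OF Zh] sub(2)[OF pY] Zd[OF s] Yd
      by (simp add: D_def integral_diff sub(1)[OF Zh] sub(1)[OF pY] i1 i2 e1 e2 flip: Yd Zd[OF s])
        (simp add: algebra_simps)
    have B: "norm (integral {s..s'} (\<lambda>r. Z r \<bullet> h r - Z s \<bullet> h r))
        \<le> integral {s..s'} (\<lambda>r. M * (s' - s) * norm (h r))"
    proof (rule integral_norm_bound_integral)
      show "(\<lambda>r. Z r \<bullet> h r - Z s \<bullet> h r) integrable_on {s..s'}"
        by (intro integrable_diff sub(1)[OF Zh] i1)
      show "(\<lambda>r. M * (s' - s) * norm (h r)) integrable_on {s..s'}"
        by (intro integrable_on_mult_right sub(1)[OF nh])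
      fix r assume r: "r \<in> {s..s'}"
      have "norm (Z s - Z r) \<le> M * (r - s)" using Zd[of s r] ip[of s r] r s by auto
      also have "\<dots> \<le> M * (s' - s)" using r \<open>0 \<le> M\<close> by (intro mult_left_mono) auto
      finally have "norm (Z r - Z s) \<le> M * (s' - s)" by (simp add: norm_minus_commute)
      then have "norm (Z r - Z s) * norm (h r) \<le> M * (s' - s) * norm (h r)"
        by (intro mult_right_mono) auto
      then show "norm (Z r \<bullet> h r - Z s \<bullet> h r) \<le> M * (s' - s) * norm (h r)"
        using Cauchy_Schwarz_ineq2[of "Z r - Z s" "h r"] by (simp add: inner_diff_left)
    qed
    have E: "norm (integral {s..s'} (\<lambda>r. p r \<bullet> Y r - p r \<bullet> Y s')) \<le> M * (H s' - H s) * (s' - s)"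
    proof (rule integral_norm_le_const)
      show "(\<lambda>r. p r \<bullet> Y r - p r \<bullet> Y s') integrable_on {s..s'}"
        by (intro integrable_diff sub(1)[OF pY] i2)
      fix r assume r: "r \<in> {s..s'}"
      have "Y s' - Y r = integral {r..s'} h"
        unfolding Y_def using r s by (intro integral_subinterval(2)[OF h]) auto
      also have "norm \<dots> \<le> integral {r..s'} (\<lambda>r. norm (h r))"
        using r s by (intro integral_norm_bound_integral integral_subinterval(1)[OF h]
            integral_subinterval(1)[OF nh]) auto
      also have "\<dots> \<le> integral {s..s'} (\<lambda>r. norm (h r))"
        using r s by (intro integral_subset_le integral_subinterval(1)[OF nh]) auto
      finally have "norm (Y r - Y s') \<le> H s' - H s" by (simp add: Hd norm_minus_commute)
      then have "norm (p r) * norm (Y r - Y s') \<le> M * (H s' - H s)"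
        using M[of r] r s \<open>0 \<le> M\<close> by (intro mult_mono) auto
      then show "norm (p r \<bullet> Y r - p r \<bullet> Y s') \<le> M * (H s' - H s)"
        using Cauchy_Schwarz_ineq2[of "p r" "Y r - Y s'"] by (simp add: inner_diff_right)
    qed (use s in auto)
    have "\<bar>D s' - D s\<bar> \<le> M * (s' - s) * (H s' - H s) + M * (H s' - H s) * (s' - s)"
    proof -
      have "\<bar>x - y\<bar> \<le> u + v" if "norm x \<le> u" "norm y \<le> v" for x y u v :: real
        using that unfolding real_norm_def by linarith
      from this[OF B E] show ?thesis
        unfolding A by (simp add: Hd)
    qed
    then show "\<bar>D s' - D s\<bar> \<le> 2 * M * (s' - s) * (H s' - H s)"
      by (simp add: algebra_simps)
  qed
  moreover have "D a = 0" by (simp add: D_def Y_def)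
  moreover have "Z b = z" using Z[of b] ab by simp
  ultimately show ?thesis by (simp add: D_def Y_def)
qed

section \<open>Quadratic error bounds and elementary estimates\<close>

text \<open>
  Along the segment from \<open>x\<close> to \<open>x + h\<close> the function minus its upper quadratic model has nonpositive
  derivative. The lower bound is the upper bound for \<open>- F\<close>. The factor \<open>1 / 2\<close> matters:
  with it the constant in \<open>cost_quadratic_growth\<close> is half of \<open>\<lambda> - c T (1 + T)\<close>.
\<close>

lemma gradient_lipschitz_quadratic_bound:
  fixes F :: "'a::real_inner \<Rightarrow> real"
  assumes grad: "\<And>x. GDERIV F x :> DF x"
    and lip: "\<And>x y. norm (DF x - DF y) \<le> c * norm (x - y)"
  shows "\<bar>F (x + h) - F x - DF x \<bullet> h\<bar> \<le> c / 2 * (norm h)\<^sup>2"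
proof -
  have upper: "G (x + h) - G x - DG x \<bullet> h \<le> c / 2 * (norm h)\<^sup>2"
    if grad: "\<And>x. GDERIV G x :> DG x" and lip: "\<And>x y. norm (DG x - DG y) \<le> c * norm (x - y)"
    for G :: "'a \<Rightarrow> real" and DG
  proof -
    define \<psi> where "\<psi> \<tau> = G (x + \<tau> *\<^sub>R h) - \<tau> * (DG x \<bullet> h) - c / 2 * \<tau>\<^sup>2 * (norm h)\<^sup>2" for \<tau>
    have "\<psi> 1 \<le> \<psi> 0"
    proof (rule DERIV_nonpos_imp_nonincreasing[of 0 1])
      fix \<tau> :: real assume \<tau>: "0 \<le> \<tau>" "\<tau> \<le> 1"
      have "((\<lambda>\<tau>. G (x + \<tau> *\<^sub>R h)) has_derivative (\<lambda>r. (r *\<^sub>R h) \<bullet> DG (x + \<tau> *\<^sub>R h))) (at \<tau>)"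
        by (rule has_derivative_compose[of "\<lambda>\<tau>. x + \<tau> *\<^sub>R h" "\<lambda>r. r *\<^sub>R h"])
          (use grad in \<open>auto simp: gderiv_def intro!: derivative_eq_intros\<close>)
      then have "((\<lambda>\<tau>. G (x + \<tau> *\<^sub>R h)) has_real_derivative (DG (x + \<tau> *\<^sub>R h) \<bullet> h)) (at \<tau>)"
        unfolding has_field_derivative_def
        by (rule has_derivative_eq_rhs) (simp add: fun_eq_iff inner_commute mult.commute)
      then have d: "(\<psi> has_real_derivative
          (DG (x + \<tau> *\<^sub>R h) \<bullet> h - DG x \<bullet> h - c * \<tau> * (norm h)\<^sup>2)) (at \<tau>)"
        unfolding \<psi>_def by (auto intro!: derivative_eq_intros)
      have "(DG (x + \<tau> *\<^sub>R h) - DG x) \<bullet> h \<le> norm (DG (x + \<tau> *\<^sub>R h) - DG x) * norm h"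
        by (rule norm_cauchy_schwarz)
      also have "\<dots> \<le> c * norm (\<tau> *\<^sub>R h) * norm h"
        using lip[of "x + \<tau> *\<^sub>R h" x] by (intro mult_right_mono) auto
      also have "\<dots> = c * \<tau> * (norm h)\<^sup>2" using \<tau> by (simp add: power2_eq_square)
      finally have "DG (x + \<tau> *\<^sub>R h) \<bullet> h - DG x \<bullet> h - c * \<tau> * (norm h)\<^sup>2 \<le> 0"
        by (simp add: inner_diff_left)
      with d show "\<exists>y. DERIV \<psi> \<tau> :> y \<and> y \<le> 0" by blast
    qed simp
    then show ?thesis by (simp add: \<psi>_def)
  qed
  have "GDERIV (\<lambda>x. - F x) y :> - DF y" for y
    using grad[of y] unfolding gderiv_def by (auto intro!: derivative_eq_intros)
  moreover have "norm (- DF x - - DF y) \<le> c * norm (x - y)" for x y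
    using lip[of x y] by (simp add: norm_minus_commute)
  ultimately have "(- F (x + h)) - (- F x) - (- DF x) \<bullet> h \<le> c / 2 * (norm h)\<^sup>2"
    by (rule upper)
  with upper[OF grad lip] show ?thesis
    unfolding inner_minus_left by linarith
qed

lemma has_derivative_of_quadratic_error:
  fixes f :: "'a::real_normed_vector \<Rightarrow> 'b::real_normed_vector"
  assumes f': "bounded_linear f'"
    and bound: "\<And>y. y \<in> S \<Longrightarrow> norm (f y - f x - f' (y - x)) \<le> K * (norm (y - x))\<^sup>2"
  shows "(f has_derivative f') (at x within S)"
  unfolding has_derivative_iff_norm
proof (rule conjI[OF f'], rule Lim_null_comparison)
  have "((\<lambda>y. K * norm (y - x)) \<longlongrightarrow> K * norm (x - x)) (at x within S)"
    by (intro tendsto_intros)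
  then show "((\<lambda>y. K * norm (y - x)) \<longlongrightarrow> 0) (at x within S)" by simp
  show "\<forall>\<^sub>F y in at x within S. norm (norm (f y - f x - f' (y - x)) / norm (y - x)) \<le> K * norm (y - x)"
    unfolding eventually_at_filter
  proof (rule always_eventually, intro allI impI)
    fix y assume y: "y \<noteq> x" "y \<in> S"
    have "norm (f y - f x - f' (y - x)) \<le> K * norm (y - x) * norm (y - x)"
      using bound[OF y(2)] by (simp only: power2_eq_square mult.assoc)
    then show "norm (norm (f y - f x - f' (y - x)) / norm (y - x)) \<le> K * norm (y - x)"
      using y(1) by (simp add: pos_divide_le_eq)
  qed
qed

lemma power2_norm_diff_le:
  "\<bar>(norm a)\<^sup>2 - (norm b)\<^sup>2\<bar> \<le> norm (a - b) * (norm a + norm b)"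
proof -
  have "(norm a)\<^sup>2 - (norm b)\<^sup>2 = (norm a - norm b) * (norm a + norm b)"
    by (simp add: power2_eq_square algebra_simps)
  then have "\<bar>(norm a)\<^sup>2 - (norm b)\<^sup>2\<bar> = \<bar>norm a - norm b\<bar> * (norm a + norm b)"
    by (simp add: abs_mult)
  then show ?thesis
    using mult_right_mono[OF norm_triangle_ineq3[of a b], of "norm a + norm b"] by simp
qed

lemma square_sum_le:
  fixes a b :: real
  shows "(1 + a)\<^sup>2 \<le> 2 * (1 + a\<^sup>2)" "(1 + a + b)\<^sup>2 \<le> 3 * (1 + a\<^sup>2 + b\<^sup>2)"
proof -
  have "0 \<le> (1 - a)\<^sup>2" "0 \<le> (1 - b)\<^sup>2" "0 \<le> (a - b)\<^sup>2" by auto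
  then show "(1 + a)\<^sup>2 \<le> 2 * (1 + a\<^sup>2)" "(1 + a + b)\<^sup>2 \<le> 3 * (1 + a\<^sup>2 + b\<^sup>2)"
    by (auto simp: power2_eq_square algebra_simps)
qed

lemma continuous_on_strip_of_lipschitz:
  fixes f :: "'a::real_normed_vector \<Rightarrow> real \<Rightarrow> 'b::real_normed_vector"
  assumes bound: "\<And>x y t s. t \<in> S \<Longrightarrow> s \<in> S \<Longrightarrow>
    norm (f x t - f y s) \<le> C * norm (x - y) + C * \<bar>t - s\<bar> * (1 + norm x + norm y)"
  shows "continuous_on (UNIV \<times> S) (\<lambda>(x, t). f x t)"
  unfolding continuous_on_def
proof (rule ballI)
  fix p :: "'a \<times> real" assume p: "p \<in> UNIV \<times> S"
  define g where "g z = C * norm (fst z - fst p) + C * \<bar>snd z - snd p\<bar> * (1 + norm (fst z) + norm (fst p))"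
    for z :: "'a \<times> real"
  have "(g \<longlongrightarrow> C * norm (fst p - fst p) + C * \<bar>snd p - snd p\<bar> * (1 + norm (fst p) + norm (fst p)))
      (at p within UNIV \<times> S)"
    unfolding g_def by (intro tendsto_intros)
  then have g0: "(g \<longlongrightarrow> 0) (at p within UNIV \<times> S)" by simp
  have "((\<lambda>z. (case z of (x, t) \<Rightarrow> f x t) - (case p of (x, t) \<Rightarrow> f x t)) \<longlongrightarrow> 0) (at p within UNIV \<times> S)"
  proof (rule Lim_null_comparison[OF _ g0])
    show "\<forall>\<^sub>F z in at p within UNIV \<times> S.
        norm ((case z of (x, t) \<Rightarrow> f x t) - (case p of (x, t) \<Rightarrow> f x t)) \<le> g z"
      unfolding eventually_at_filter
    proof (rule always_eventually, intro allI impI)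
      fix z :: "'a \<times> real" assume "z \<in> UNIV \<times> S"
      then show "norm ((case z of (x, t) \<Rightarrow> f x t) - (case p of (x, t) \<Rightarrow> f x t)) \<le> g z"
        using bound[of "snd z" "snd p" "fst z" "fst p"] p by (auto simp: g_def split_beta)
    qed
  qed
  then show "((\<lambda>(x, t). f x t) \<longlongrightarrow> (case p of (x, t) \<Rightarrow> f x t)) (at p within UNIV \<times> S)"
    by (rule LIM_zero_cancel)
qed

section \<open>Fixed points and ordinary differential equations\<close>

text \<open>
  Banach's fixed point theorem for the weighted norm \<open>sup (norm (X s) / w s)\<close>. It is applied
  to the bounded continuous functions \<open>X / w\<close> on the line; outside of the interval the map is continued
  by its values at the end points. The weight 1 is used for extremals, an exponential weight for initial value problems.
\<close>

lemma weighted_contraction_fixed_point: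
  fixes \<Phi> :: "(real \<Rightarrow> 'a::banach) \<Rightarrow> real \<Rightarrow> 'a"
  assumes ab: "a \<le> b" and w: "continuous_on {a..b} w" "\<And>s. s \<in> {a..b} \<Longrightarrow> 0 < w s"
    and q: "0 \<le> q" "q < 1"
    and cont: "\<And>X. continuous_on {a..b} X \<Longrightarrow> continuous_on {a..b} (\<Phi> X)"
    and contraction: "\<And>X Y m s. continuous_on {a..b} X \<Longrightarrow> continuous_on {a..b} Y \<Longrightarrow>
      (\<And>r. r \<in> {a..b} \<Longrightarrow> norm (X r - Y r) \<le> m * w r) \<Longrightarrow> s \<in> {a..b} \<Longrightarrow>
      norm (\<Phi> X s - \<Phi> Y s) \<le> q * m * w s"
  obtains X where "continuous_on {a..b} X" "\<And>s. s \<in> {a..b} \<Longrightarrow> X s = \<Phi> X s"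
proof -
  \<comment> \<open>The unknown of the fixed point problem is f = X / w, and E recovers X from it.\<close>
  define E :: "(real \<Rightarrow>\<^sub>C 'a) \<Rightarrow> real \<Rightarrow> 'a" where "E f s = w s *\<^sub>R f s" for f s
  define G :: "(real \<Rightarrow>\<^sub>C 'a) \<Rightarrow> real \<Rightarrow>\<^sub>C 'a" where
    "G f = Bcontfun (ext_cont (\<lambda>s. \<Phi> (E f) s /\<^sub>R w s) a b)" for f
  have E: "continuous_on {a..b} (E f)" for f
    unfolding E_def by (intro continuous_intros w continuous_on_apply_bcontfun)
  have Gc: "continuous_on (cbox a b) (\<lambda>s. \<Phi> (E f) s /\<^sub>R w s)" for f
    using w(2) by (auto intro!: continuous_intros cont[OF E] w(1) simp: cbox_interval) (metis order_less_irrefl)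
  have "ext_cont (\<lambda>s. \<Phi> (E f) s /\<^sub>R w s) a b \<in> bcontfun" for f
    unfolding bcontfun_def
  proof (intro CollectI conjI)
    show "continuous_on UNIV (ext_cont (\<lambda>s. \<Phi> (E f) s /\<^sub>R w s) a b)"
      by (rule continuous_on_ext_cont[OF Gc])
    show "bounded (range (ext_cont (\<lambda>s. \<Phi> (E f) s /\<^sub>R w s) a b))"
      unfolding ext_cont_def
      by (rule clamp_bounded) (intro compact_imp_bounded compact_continuous_image[OF Gc] compact_cbox)
  qed
  then have G: "apply_bcontfun (G f) s = \<Phi> (E f) (clamp a b s) /\<^sub>R w (clamp a b s)" for f s
    unfolding G_def by (simp add: Bcontfun_inverse ext_cont_def)
  have clamp: "clamp a b s \<in> {a..b}" for s
    using clamp_in_interval[of a b s] ab by (simp add: cbox_interval)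
  have "dist (G f) (G g) \<le> q * dist f g" for f g
  proof (rule dist_bound)
    fix s
    let ?s = "clamp a b s"
    have "norm (\<Phi> (E f) ?s - \<Phi> (E g) ?s) \<le> q * dist f g * w ?s"
    proof (rule contraction[OF E E _ clamp])
      fix r assume r: "r \<in> {a..b}"
      have "norm (E f r - E g r) = w r * dist (f r) (g r)"
        using w(2)[OF r] by (simp add: E_def dist_norm flip: scaleR_diff_right)
      also have "\<dots> \<le> w r * dist f g"
        using w(2)[OF r] by (intro mult_left_mono dist_bounded) auto
      finally show "norm (E f r - E g r) \<le> dist f g * w r" by (simp add: mult.commute)
    qed
    then show "dist (G f s) (G g s) \<le> q * dist f g"
      using w(2)[OF clamp[of s]] by (simp add: G dist_norm flip: scaleR_diff_right)
        (simp add: field_simps)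
  qed
  then obtain f where f: "G f = f"
    using banach_fix_type[OF q, of G] by blast
  show ?thesis
  proof (rule that[of "E f"])
    show "continuous_on {a..b} (E f)" by (rule E)
    fix s assume s: "s \<in> {a..b}"
    then have "clamp a b s = s" by (intro clamp_cancel_cbox) (simp add: cbox_interval)
    then have "f s = \<Phi> (E f) s /\<^sub>R w s" using G[of f s] f by simp
    then show "E f s = \<Phi> (E f) s" using w(2)[OF s] by (simp add: E_def)
  qed
qed

lemma exp_integral_le:
  fixes k :: real
  assumes "0 < k" "a \<le> s"
  shows "integral {a..s} (\<lambda>r. exp (k * (r - a))) \<le> exp (k * (s - a)) / k"
proof -
  have "((\<lambda>r. exp (k * (r - a))) has_integral (exp (k * (s - a)) / k - exp (k * (a - a)) / k)) {a..s}"
    using assms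
    by (intro fundamental_theorem_of_calculus)
      (auto intro!: derivative_eq_intros simp flip: has_real_derivative_iff_has_vector_derivative)
  then show ?thesis using assms(1) by (simp add: integral_unique)
qed

text \<open>
  With the weight \<open>exp (2 K (s - a))\<close> the Picard map contracts by the factor \<open>1 / 2\<close> on the whole
  interval, and a single fixed point gives a global solution.
\<close>

lemma lipschitz_ode_solution_exists:
  fixes G :: "'a::banach \<Rightarrow> real \<Rightarrow> 'a"
  assumes ab: "a \<le> b" and G: "continuous_on (UNIV \<times> {a..b}) (\<lambda>(x, s). G x s)"
    and lip: "\<And>x y s. s \<in> {a..b} \<Longrightarrow> norm (G x s - G y s) \<le> L * norm (x - y)"
  obtains X where "continuous_on {a..b} X"
    "\<And>s. s \<in> {a..b} \<Longrightarrow> X s = x + integral {a..s} (\<lambda>r. G (X r) r)"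
proof -
  \<comment> \<open>The bound K is positive even if L is not; the weight has rate 2 K.\<close>
  define K where "K = \<bar>L\<bar> + 1"
  define w where "w s = exp (2 * K * (s - a))" for s
  have "0 < K" by (simp add: K_def)
  have Gc: "continuous_on {a..b} (\<lambda>r. G (X r) r)" if "continuous_on {a..b} X" for X
  proof -
    have "continuous_on {a..b} (\<lambda>r. (\<lambda>(x, s). G x s) (X r, r))"
      by (rule continuous_on_compose2[OF G]) (auto intro!: continuous_intros that)
    then show ?thesis by simp
  qed
  have Gi: "(\<lambda>r. G (X r) r) integrable_on {a..s}" if "continuous_on {a..b} X" "s \<in> {a..b}" for X s
    using that(2) by (intro integrable_continuous_real continuous_on_subset[OF Gc[OF that(1)]]) auto
  show ?thesis
  proof (rule weighted_contraction_fixed_point[of a b w "1 / 2" "\<lambda>X s. x + integral {a..s} (\<lambda>r. G (X r) r)"])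
    show "continuous_on {a..b} w" unfolding w_def by (intro continuous_intros)
    show "continuous_on {a..b} (\<lambda>s. x + integral {a..s} (\<lambda>r. G (X r) r))"
      if "continuous_on {a..b} X" for X
      by (intro continuous_intros indefinite_integral_continuous_1 integrable_continuous_real Gc that)
    fix X Y :: "real \<Rightarrow> 'a" and m s
    assume X: "continuous_on {a..b} X" and Y: "continuous_on {a..b} Y"
      and m: "\<And>r. r \<in> {a..b} \<Longrightarrow> norm (X r - Y r) \<le> m * w r" and s: "s \<in> {a..b}"
    have "0 \<le> m * w s" using order_trans[OF norm_ge_zero m[OF s]] .
    then have "0 \<le> m" by (simp add: w_def zero_le_mult_iff)
    have "norm (integral {a..s} (\<lambda>r. G (X r) r - G (Y r) r)) \<le> integral {a..s} (\<lambda>r. K * m * w r)"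
    proof (rule integral_norm_bound_integral)
      show "(\<lambda>r. G (X r) r - G (Y r) r) integrable_on {a..s}"
        by (intro integrable_diff Gi X Y s)
      show "(\<lambda>r. K * m * w r) integrable_on {a..s}"
        unfolding w_def by (intro integrable_continuous_real continuous_intros)
      fix r assume "r \<in> {a..s}"
      then have r: "r \<in> {a..b}" using s by simp
      have "L * norm (X r - Y r) \<le> K * norm (X r - Y r)"
        by (rule mult_right_mono) (auto simp: K_def)
      then have "norm (G (X r) r - G (Y r) r) \<le> K * norm (X r - Y r)"
        using lip[OF r, of "X r" "Y r"] by linarith
      also have "\<dots> \<le> K * (m * w r)" using m[OF r] \<open>0 < K\<close> by (intro mult_left_mono) auto
      finally show "norm (G (X r) r - G (Y r) r) \<le> K * m * w r" by (simp add: mult.assoc)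
    qed
    also have "\<dots> = K * m * integral {a..s} w"
      by (rule Henstock_Kurzweil_Integration.integral_mult_right)
    also have "\<dots> \<le> K * m * (w s / (2 * K))"
      unfolding w_def using exp_integral_le[of "2 * K" a s] \<open>0 < K\<close> \<open>0 \<le> m\<close> s
      by (intro mult_left_mono) auto
    also have "\<dots> = 1 / 2 * m * w s" using \<open>0 < K\<close> by simp
    finally show "norm (x + integral {a..s} (\<lambda>r. G (X r) r) - (x + integral {a..s} (\<lambda>r. G (Y r) r)))
        \<le> 1 / 2 * m * w s"
      using integral_diff[OF Gi[OF X s] Gi[OF Y s]] by simp
  qed (use ab that in \<open>auto simp: w_def\<close>)
qed


section \<open>The control problem: constants and growth of the data\<close>

locale control_problem =
  fixes F FT :: "'a::{real_inner, banach} \<Rightarrow> real"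
    and DF DFT :: "'a \<Rightarrow> 'a"
    and c T lam :: real
  assumes T_pos: "T > 0"
    and F_grad: "\<And>x. GDERIV F x :> DF x"
    and FT_grad: "\<And>x. GDERIV FT x :> DFT x"
    and F_lip: "\<And>x1 x2. norm (DF x1 - DF x2) \<le> c * norm (x1 - x2)"
    and FT_lip: "\<And>x1 x2. norm (DFT x1 - DFT x2) \<le> c * norm (x1 - x2)"
    and F_0: "norm (DF 0) \<le> c"
    and FT_0: "norm (DFT 0) \<le> c"
    and lam: "lam > c * T * (1 + T)"
begin

lemma c_nonneg: "0 \<le> c"
  using order_trans[OF norm_ge_zero F_0] .

lemma lam_pos: "0 < lam"
proof -
  have "0 \<le> c * T * (1 + T)" using c_nonneg T_pos by simp
  then show ?thesis using lam by linarith
qed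

text \<open>
  \<open>q\<close> is the contraction constant of the fixed point equation for extremals, and \<open>kappa\<close> the resulting
  Lipschitz constant of its solution in the initial state.
\<close>

definition q :: real where "q = c * T * (1 + T) / lam"

lemma q_bounds: "0 \<le> q" "q < 1"
  using c_nonneg T_pos lam lam_pos by (auto simp: q_def)

definition kappa :: real where "kappa = 1 / (1 - q)"

lemma kappa_pos: "0 < kappa"
  using q_bounds by (simp add: kappa_def)

lemma le_kappa_mult:
  assumes "m \<le> d + q * m"
  shows "m \<le> kappa * d"
  using assms q_bounds by (simp add: kappa_def field_simps)

text \<open>
  \<open>A\<close> bounds, up to the factor \<open>1 + norm x\<close>, the costate along an extremal and its Lipschitz constant
  in time; it is also a Lipschitz constant of the costate in \<open>x\<close>.
\<close>

definition A :: real where "A = c * (1 + T) * (1 + kappa)"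

lemma A_nonneg: "0 \<le> A"
  using c_nonneg T_pos kappa_pos by (simp add: A_def)

lemma A_ge: "c * (1 + T) * kappa \<le> A" "c * (1 + T) \<le> A" "c * (1 + kappa) \<le> A"
proof -
  show "c * (1 + T) * kappa \<le> A" "c * (1 + T) \<le> A"
    using c_nonneg T_pos kappa_pos by (auto simp: A_def algebra_simps)
  have "c * (1 + kappa) * 1 \<le> c * (1 + kappa) * (1 + T)"
    using c_nonneg T_pos kappa_pos by (intro mult_left_mono) auto
  then show "c * (1 + kappa) \<le> A" by (simp add: A_def mult_ac)
qed

lemma DF_growth: "norm (DF x) \<le> c * (1 + norm x)"
  using norm_triangle_sub[of "DF x" "DF 0"] F_lip[of x 0] F_0 by (simp add: algebra_simps)

lemma DFT_growth: "norm (DFT x) \<le> c * (1 + norm x)"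
  using norm_triangle_sub[of "DFT x" "DFT 0"] FT_lip[of x 0] FT_0 by (simp add: algebra_simps)

lemma continuous_DF: "continuous_on S DF"
proof (rule lipschitz_on_continuous_on)
  show "c-lipschitz_on S DF"
    by (rule lipschitz_onI) (use F_lip c_nonneg in \<open>auto simp: dist_norm\<close>)
qed

lemma continuous_F: "continuous_on S F"
proof (rule continuous_at_imp_continuous_on, rule ballI)
  fix x show "isCont F x"
    using F_grad[of x] unfolding gderiv_def by (rule has_derivative_continuous)
qed

lemma F_quadratic: "\<bar>F (x + h) - F x - DF x \<bullet> h\<bar> \<le> c / 2 * (norm h)\<^sup>2"
  by (rule gradient_lipschitz_quadratic_bound[OF F_grad F_lip])

lemma FT_quadratic: "\<bar>FT (x + h) - FT x - DFT x \<bullet> h\<bar> \<le> c / 2 * (norm h)\<^sup>2"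
  by (rule gradient_lipschitz_quadratic_bound[OF FT_grad FT_lip])

lemma F_diff: "\<bar>F y - F x\<bar> \<le> 2 * c * (1 + norm x + norm y) * norm (y - x)"
proof -
  let ?h = "y - x"
  have "x + ?h = y" by simp
  with F_quadratic[of x ?h] have "\<bar>F y - F x - DF x \<bullet> ?h\<bar> \<le> c / 2 * (norm ?h)\<^sup>2"
    by (simp only:)
  then have 1: "\<bar>F y - F x\<bar> \<le> \<bar>DF x \<bullet> ?h\<bar> + c / 2 * (norm ?h)\<^sup>2"
    by linarith
  have "norm (DF x) * norm ?h \<le> c * (1 + norm x) * norm ?h"
    by (intro mult_right_mono DF_growth) auto
  then have 2: "\<bar>DF x \<bullet> ?h\<bar> \<le> c * (1 + norm x) * norm ?h"
    using Cauchy_Schwarz_ineq2[of "DF x" ?h] by linarith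
  have "c / 2 * norm ?h * norm ?h \<le> c / 2 * (norm x + norm y) * norm ?h"
    using norm_triangle_ineq4[of y x] c_nonneg
    by (intro mult_right_mono mult_left_mono) (auto simp: add.commute)
  then have 3: "c / 2 * (norm ?h)\<^sup>2 \<le> c / 2 * (norm x + norm y) * norm ?h"
    by (simp add: power2_eq_square mult.assoc)
  have "\<bar>F y - F x\<bar> \<le> (c * (1 + norm x) + c / 2 * (norm x + norm y)) * norm ?h"
    using 1 2 3 unfolding distrib_right[of "c * (1 + norm x)"] by linarith
  also have "\<dots> \<le> 2 * c * (1 + norm x + norm y) * norm ?h"
  proof (intro mult_right_mono)
    have "0 \<le> c * norm x" "0 \<le> c * norm y" using c_nonneg by auto
    then show "c * (1 + norm x) + c / 2 * (norm x + norm y) \<le> 2 * c * (1 + norm x + norm y)"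
      using c_nonneg by (simp add: algebra_simps)
  qed simp
  finally show ?thesis .
qed

section \<open>Extremals\<close>

definition costate :: "(real \<Rightarrow> 'a) \<Rightarrow> real \<Rightarrow> 'a" where
  "costate X s = DFT (X T) + integral {s..T} (\<lambda>r. DF (X r))"

definition extremal :: "'a \<Rightarrow> real \<Rightarrow> (real \<Rightarrow> 'a) \<Rightarrow> bool" where
  "extremal x t X \<longleftrightarrow> continuous_on {t..T} X \<and>
     (\<forall>s\<in>{t..T}. X s = x - (1 / lam) *\<^sub>R integral {t..s} (costate X))"

lemma extremal_continuous: "extremal x t X \<Longrightarrow> continuous_on {t..T} X"
  by (simp add: extremal_def)

lemma extremal_eq:
  "extremal x t X \<Longrightarrow> s \<in> {t..T} \<Longrightarrow> X s = x - (1 / lam) *\<^sub>R integral {t..s} (costate X)"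
  unfolding extremal_def by blast

lemma DF_comp_continuous: "continuous_on S X \<Longrightarrow> continuous_on S (\<lambda>r. DF (X r))"
  by (rule continuous_on_compose2[OF continuous_DF[of UNIV]]) auto

lemma F_comp_continuous: "continuous_on S X \<Longrightarrow> continuous_on S (\<lambda>r. F (X r))"
  by (rule continuous_on_compose2[OF continuous_F[of UNIV]]) auto

lemma DF_comp_integrable:
  "continuous_on {t..T} X \<Longrightarrow> t \<le> s \<Longrightarrow> s' \<le> T \<Longrightarrow> (\<lambda>r. DF (X r)) integrable_on {s..s'}"
  by (intro integrable_continuous_real DF_comp_continuous) (auto elim: continuous_on_subset)

lemma costate_continuous:
  "continuous_on {t..T} X \<Longrightarrow> continuous_on {t..T} (costate X)"
  unfolding costate_def
  by (intro continuous_intros indefinite_integral_continuous_1' DF_comp_integrable) auto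

lemma costate_integrable:
  "continuous_on {t..T} X \<Longrightarrow> t \<le> s \<Longrightarrow> s' \<le> T \<Longrightarrow> costate X integrable_on {s..s'}"
  using costate_continuous[of t X]
  by (intro integrable_continuous_real) (auto elim: continuous_on_subset)

lemma costate_diff:
  assumes X: "continuous_on {t..T} X" and Y: "continuous_on {t..T} Y" and "0 \<le> t"
    and m: "\<And>r. r \<in> {t..T} \<Longrightarrow> norm (X r - Y r) \<le> m" and s: "s \<in> {t..T}"
  shows "norm (costate X s - costate Y s) \<le> c * (1 + T) * m"
proof -
  have m0: "0 \<le> m" using order_trans[OF norm_ge_zero m[OF s]] .
  have i: "(\<lambda>r. DF (X r)) integrable_on {s..T}" "(\<lambda>r. DF (Y r)) integrable_on {s..T}"
    using s by (auto intro: DF_comp_integrable X Y)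
  have le: "c * norm (X r - Y r) \<le> c * m" if "r \<in> {t..T}" for r
    using m[OF that] c_nonneg by (rule mult_left_mono)
  have "norm (integral {s..T} (\<lambda>r. DF (X r) - DF (Y r))) \<le> c * m * (T - s)"
  proof (rule integral_norm_le_const)
    show "norm (DF (X r) - DF (Y r)) \<le> c * m" if "r \<in> {s..T}" for r
      using order_trans[OF F_lip le] that s by auto
  qed (use s i in \<open>auto intro: integrable_diff\<close>)
  also have "\<dots> \<le> c * m * T"
    using c_nonneg m0 s \<open>0 \<le> t\<close> by (intro mult_left_mono) auto
  finally have 1: "norm (integral {s..T} (\<lambda>r. DF (X r)) - integral {s..T} (\<lambda>r. DF (Y r))) \<le> c * m * T"
    using i by (simp add: integral_diff)
  have 2: "norm (DFT (X T) - DFT (Y T)) \<le> c * m"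
    using order_trans[OF FT_lip le] s by auto
  have "costate X s - costate Y s = (DFT (X T) - DFT (Y T))
      + (integral {s..T} (\<lambda>r. DF (X r)) - integral {s..T} (\<lambda>r. DF (Y r)))"
    by (simp add: costate_def)
  also have "norm \<dots> \<le> c * m + c * m * T"
    by (rule norm_triangle_mono[OF 2 1])
  finally show ?thesis by (simp add: algebra_simps)
qed

lemma costate_bound:
  assumes X: "continuous_on {t..T} X" and "0 \<le> t"
    and m: "\<And>r. r \<in> {t..T} \<Longrightarrow> norm (X r) \<le> m" and s: "s \<in> {t..T}"
  shows "norm (costate X s) \<le> c * (1 + T) * (1 + m)"
proof -
  have m0: "0 \<le> m" using order_trans[OF norm_ge_zero m[OF s]] .
  have le: "c * (1 + norm (X r)) \<le> c * (1 + m)" if "r \<in> {t..T}" for r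
    using m[OF that] c_nonneg by (intro mult_left_mono) auto
  have "norm (integral {s..T} (\<lambda>r. DF (X r))) \<le> c * (1 + m) * (T - s)"
  proof (rule integral_norm_le_const)
    show "norm (DF (X r)) \<le> c * (1 + m)" if "r \<in> {s..T}" for r
      using order_trans[OF DF_growth le] that s by auto
  qed (use s in \<open>auto intro: DF_comp_integrable X\<close>)
  also have "\<dots> \<le> c * (1 + m) * T"
    using c_nonneg m0 s \<open>0 \<le> t\<close> by (intro mult_left_mono) auto
  finally have "norm (costate X s) \<le> c * (1 + m) + c * (1 + m) * T"
    unfolding costate_def using order_trans[OF DFT_growth le] s by (intro norm_triangle_mono) auto
  then show ?thesis by (simp add: algebra_simps)
qed

text \<open>
  Where \<open>q\<close> comes from: an interval of length at most \<open>T\<close>, the factor \<open>1 / \<lambda>\<close>, and the bound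
  \<open>c (1 + T)\<close> for costates, in which 1 stands for the terminal cost and \<open>T\<close> for the running cost.
\<close>

lemma scaled_integral_le:
  fixes f :: "real \<Rightarrow> 'a"
  assumes i: "f integrable_on {t..s}" and t: "0 \<le> t" "t \<le> s" "s \<le> T"
    and B: "\<And>r. r \<in> {t..s} \<Longrightarrow> norm (f r) \<le> c * (1 + T) * m" and m: "0 \<le> m"
  shows "norm ((1 / lam) *\<^sub>R integral {t..s} f) \<le> q * m"
proof -
  have "norm (integral {t..s} f) \<le> c * (1 + T) * m * (s - t)"
    by (rule integral_norm_le_const[OF i t(2) B])
  also have "\<dots> \<le> c * (1 + T) * m * T"
    using c_nonneg T_pos m t by (intro mult_left_mono) auto
  finally show ?thesis using lam_pos by (simp add: q_def field_simps)
qed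

lemma extremal_exists:
  assumes t: "t \<in> {0..T}"
  obtains X where "extremal x t X"
proof (rule weighted_contraction_fixed_point[of t T "\<lambda>_. 1" q
      "\<lambda>X s. x - (1 / lam) *\<^sub>R integral {t..s} (costate X)"])
  fix X :: "real \<Rightarrow> 'a" assume "continuous_on {t..T} X"
  then show "continuous_on {t..T} (\<lambda>s. x - (1 / lam) *\<^sub>R integral {t..s} (costate X))"
    by (intro continuous_intros indefinite_integral_continuous_1 costate_integrable) auto
next
  fix X Y :: "real \<Rightarrow> 'a" and m s
  assume X: "continuous_on {t..T} X" and Y: "continuous_on {t..T} Y"
    and m: "\<And>r. r \<in> {t..T} \<Longrightarrow> norm (X r - Y r) \<le> m * 1" and s: "s \<in> {t..T}"
  have i: "costate X integrable_on {t..s}" "costate Y integrable_on {t..s}"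
    using s by (auto intro: costate_integrable X Y)
  have "norm ((1 / lam) *\<^sub>R integral {t..s} (\<lambda>r. costate X r - costate Y r)) \<le> q * m"
  proof (rule scaled_integral_le)
    show "(\<lambda>r. costate X r - costate Y r) integrable_on {t..s}" by (intro integrable_diff i)
    show "norm (costate X r - costate Y r) \<le> c * (1 + T) * m" if "r \<in> {t..s}" for r
      using costate_diff[OF X Y _ m, of r] that s t by auto
    show "0 \<le> m" using order_trans[OF norm_ge_zero m[OF s]] by simp
  qed (use s t in auto)
  then show "norm (x - (1 / lam) *\<^sub>R integral {t..s} (costate X)
      - (x - (1 / lam) *\<^sub>R integral {t..s} (costate Y))) \<le> q * m * 1"
    using i by (simp add: integral_diff scaleR_diff_right norm_minus_commute)
next
  fix X assume "continuous_on {t..T} X"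
    "\<And>s. s \<in> {t..T} \<Longrightarrow> X s = x - (1 / lam) *\<^sub>R integral {t..s} (costate X)"
  then show thesis by (intro that[of X]) (simp add: extremal_def)
qed (use t q_bounds in auto)

text \<open>
  At a point where the distance of the two extremals is maximal, it is at most \<open>norm (x - y)\<close> plus \<open>q\<close>
  times itself.
\<close>

lemma extremal_lipschitz:
  assumes X: "extremal x t X" and Y: "extremal y t Y" and t: "t \<in> {0..T}" and s: "s \<in> {t..T}"
  shows "norm (X s - Y s) \<le> kappa * norm (x - y)"
proof -
  have cX: "continuous_on {t..T} X" and cY: "continuous_on {t..T} Y"
    by (rule extremal_continuous[OF X], rule extremal_continuous[OF Y])
  have "\<exists>r\<in>{t..T}. \<forall>s\<in>{t..T}. norm (X s - Y s) \<le> norm (X r - Y r)"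
    using t by (intro continuous_attains_sup continuous_intros cX cY) auto
  then obtain r where r: "r \<in> {t..T}"
    and max: "\<And>s. s \<in> {t..T} \<Longrightarrow> norm (X s - Y s) \<le> norm (X r - Y r)"
    by blast
  define m where "m = norm (X r - Y r)"
  have i: "costate X integrable_on {t..r}" "costate Y integrable_on {t..r}"
    using r by (auto intro: costate_integrable cX cY)
  have b: "norm ((1 / lam) *\<^sub>R integral {t..r} (\<lambda>r. costate X r - costate Y r)) \<le> q * m"
  proof (rule scaled_integral_le)
    show "(\<lambda>r. costate X r - costate Y r) integrable_on {t..r}" by (intro integrable_diff i)
    show "norm (costate X s - costate Y s) \<le> c * (1 + T) * m" if "s \<in> {t..r}" for s
      using costate_diff[OF cX cY _ max, of s] that r t by (auto simp: m_def)
  qed (use r t in \<open>auto simp: m_def\<close>)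
  have "X r - Y r = (x - y) - (1 / lam) *\<^sub>R integral {t..r} (\<lambda>r. costate X r - costate Y r)"
    unfolding extremal_eq[OF X r] extremal_eq[OF Y r] integral_diff[OF i] scaleR_diff_right by simp
  then have "m \<le> norm (x - y) + norm ((1 / lam) *\<^sub>R integral {t..r} (\<lambda>r. costate X r - costate Y r))"
    unfolding m_def by (simp only: norm_triangle_ineq4)
  then have "m \<le> norm (x - y) + q * m" using b by linarith
  then have "m \<le> kappa * norm (x - y)" by (rule le_kappa_mult)
  then show ?thesis using max[OF s] by (simp add: m_def)
qed

lemma extremal_bound:
  assumes X: "extremal x t X" and t: "t \<in> {0..T}" and s: "s \<in> {t..T}"
  shows "norm (X s) \<le> kappa * (1 + norm x)"
proof -
  have cX: "continuous_on {t..T} X" by (rule extremal_continuous[OF X])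
  have "\<exists>r\<in>{t..T}. \<forall>s\<in>{t..T}. norm (X s) \<le> norm (X r)"
    using t by (intro continuous_attains_sup continuous_intros cX) auto
  then obtain r where r: "r \<in> {t..T}" and max: "\<And>s. s \<in> {t..T} \<Longrightarrow> norm (X s) \<le> norm (X r)"
    by blast
  define m where "m = norm (X r)"
  have b: "norm ((1 / lam) *\<^sub>R integral {t..r} (costate X)) \<le> q * (1 + m)"
  proof (rule scaled_integral_le)
    show "costate X integrable_on {t..r}" using r by (auto intro: costate_integrable cX)
    show "norm (costate X s) \<le> c * (1 + T) * (1 + m)" if "s \<in> {t..r}" for s
      using costate_bound[OF cX _ max, of s] that r t by (auto simp: m_def)
  qed (use r t in \<open>auto simp: m_def\<close>)
  have "X r = x - (1 / lam) *\<^sub>R integral {t..r} (costate X)"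
    by (rule extremal_eq[OF X r])
  then have "m \<le> norm x + norm ((1 / lam) *\<^sub>R integral {t..r} (costate X))"
    unfolding m_def by (simp only: norm_triangle_ineq4)
  then have "m \<le> (1 + norm x) + q * m" using b q_bounds by (simp add: algebra_simps)
  then have "m \<le> kappa * (1 + norm x)" by (rule le_kappa_mult)
  then show ?thesis using max[OF s] by (simp add: m_def)
qed

lemma extremal_DF_bound:
  assumes "extremal x t X" "t \<in> {0..T}" "s \<in> {t..T}"
  shows "norm (DF (X s)) \<le> A * (1 + norm x)"
proof -
  have "norm (DF (X s)) \<le> c * (1 + kappa * (1 + norm x))"
    using c_nonneg extremal_bound[OF assms] by (intro order_trans[OF DF_growth] mult_left_mono) auto
  also have "\<dots> \<le> c * ((1 + kappa) * (1 + norm x))"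
    using c_nonneg by (intro mult_left_mono) (auto simp: algebra_simps)
  also have "\<dots> = c * (1 + kappa) * (1 + norm x)" by simp
  also have "\<dots> \<le> A * (1 + norm x)" by (intro mult_right_mono A_ge) auto
  finally show ?thesis .
qed

lemma extremal_costate_bound:
  assumes X: "extremal x t X" and t: "t \<in> {0..T}" and s: "s \<in> {t..T}"
  shows "norm (costate X s) \<le> A * (1 + norm x)"
proof -
  have "norm (costate X s) \<le> c * (1 + T) * (1 + kappa * (1 + norm x))"
    using t s extremal_bound[OF X t] by (intro costate_bound[OF extremal_continuous[OF X]]) auto
  also have "\<dots> \<le> c * (1 + T) * ((1 + kappa) * (1 + norm x))"
    using c_nonneg T_pos by (intro mult_left_mono) (auto simp: algebra_simps)
  finally show ?thesis by (simp add: A_def mult_ac)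
qed

lemma extremal_costate_time:
  assumes X: "extremal x t X" and t: "t \<in> {0..T}" and s: "t \<le> s" "s \<le> s'" "s' \<le> T"
  shows "norm (costate X s' - costate X s) \<le> A * (1 + norm x) * (s' - s)"
proof -
  have cX: "continuous_on {t..T} X" by (rule extremal_continuous[OF X])
  have "costate X s - costate X s' = integral {s..s'} (\<lambda>r. DF (X r))"
    using integral_subinterval(3)[OF DF_comp_integrable[OF cX] s] by (simp add: costate_def)
  moreover have "norm (integral {s..s'} (\<lambda>r. DF (X r))) \<le> A * (1 + norm x) * (s' - s)"
    using s extremal_DF_bound[OF X t] by (intro integral_norm_le_const DF_comp_integrable[OF cX]) auto
  ultimately show ?thesis by (simp add: norm_minus_commute)
qed

lemma extremal_time:
  assumes X: "extremal x t X" and t: "t \<in> {0..T}" and s: "t \<le> s" "s \<le> s'" "s' \<le> T"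
  shows "X s - X s' = (1 / lam) *\<^sub>R integral {s..s'} (costate X)"
    "norm (X s' - X s) \<le> A / lam * (1 + norm x) * (s' - s)"
proof -
  have cX: "continuous_on {t..T} X" by (rule extremal_continuous[OF X])
  have "integral {t..s'} (costate X) - integral {t..s} (costate X) = integral {s..s'} (costate X)"
    by (rule integral_subinterval(2)[OF costate_integrable[OF cX] s]) auto
  then show *: "X s - X s' = (1 / lam) *\<^sub>R integral {s..s'} (costate X)"
    using extremal_eq[OF X, of s] extremal_eq[OF X, of s'] s by (simp flip: scaleR_diff_right)
  have "norm (integral {s..s'} (costate X)) \<le> A * (1 + norm x) * (s' - s)"
    using s extremal_costate_bound[OF X t] by (intro integral_norm_le_const costate_integrable[OF cX]) auto
  then show "norm (X s' - X s) \<le> A / lam * (1 + norm x) * (s' - s)"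
    using lam_pos by (subst norm_minus_commute, subst *) (simp add: field_simps)
qed

lemma extremal_initial: "extremal x t X \<Longrightarrow> t \<in> {0..T} \<Longrightarrow> X t = x"
  by (subst extremal_eq[of x t X t]) auto

text \<open>
  The costate refers only to later times, so an extremal solves the same equation from each of its
  own states. This is the source of the dynamic programming identity and of the feedback form of the
  costate.
\<close>

lemma extremal_restrict:
  assumes X: "extremal x t X" and t: "t \<in> {0..T}" and s: "s \<in> {t..T}"
  shows "extremal (X s) s X"
  unfolding extremal_def
proof (intro conjI ballI)
  show "continuous_on {s..T} X"
    using s by (intro continuous_on_subset[OF extremal_continuous[OF X]]) auto
  fix r assume "r \<in> {s..T}"
  then show "X r = X s - (1 / lam) *\<^sub>R integral {s..r} (costate X)"
    using extremal_time(1)[OF X t, of s r] s by (simp add: algebra_simps)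
qed

lemma extremal_costate_lipschitz:
  assumes X: "extremal x t X" and Y: "extremal y t Y" and t: "t \<in> {0..T}" and s: "s \<in> {t..T}"
  shows "norm (costate X s - costate Y s) \<le> A * norm (x - y)"
proof -
  have "norm (costate X s - costate Y s) \<le> c * (1 + T) * (kappa * norm (x - y))"
    using t s extremal_lipschitz[OF X Y t]
    by (intro costate_diff[OF extremal_continuous[OF X] extremal_continuous[OF Y]]) auto
  also have "\<dots> = c * (1 + T) * kappa * norm (x - y)" by simp
  also have "\<dots> \<le> A * norm (x - y)" by (intro mult_right_mono A_ge) auto
  finally show ?thesis .
qed

section \<open>Optimality of the extremal control\<close>

lemma cost_eq_integral:
  assumes t: "t \<in> {0..T}" and v: "v \<in> L2_controls t T"
    and X: "\<And>s. s \<in> {t..T} \<Longrightarrow> trajectory t x v s = X s"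
  shows "continuous_on {t..T} X"
    "cost lam T F FT x t v = lam / 2 * integral {t..T} (\<lambda>s. (norm (v s))\<^sup>2)
      + integral {t..T} (\<lambda>s. F (X s)) + FT (X T)"
proof -
  have "continuous_on {t..T} (trajectory t x v)"
    unfolding trajectory_def
    by (intro continuous_intros indefinite_integral_continuous_1 L2_controls_integrable_on v)
  then show c: "continuous_on {t..T} X"
    using X by (rule continuous_on_eq)
  have "(LINT s|lebesgue_on {t..T}. F (trajectory t x v s)) = (LINT s|lebesgue_on {t..T}. F (X s))"
    using X by (intro Bochner_Integration.integral_cong) auto
  also have "\<dots> = integral {t..T} (\<lambda>s. F (X s))"
    by (intro lebesgue_integral_eq_integral continuous_imp_integrable_real F_comp_continuous c) auto
  finally show "cost lam T F FT x t v = lam / 2 * integral {t..T} (\<lambda>s. (norm (v s))\<^sup>2)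
      + integral {t..T} (\<lambda>s. F (X s)) + FT (X T)"
    using X[of T] t by (simp add: cost_def L2_controls_integrable_on(4)[OF v])
qed

text \<open>
  The control of an extremal is the one that makes the derivative of the cost vanish; its running
  cost, written in terms of the costate, is \<open>running\<close>.
\<close>

definition control :: "(real \<Rightarrow> 'a) \<Rightarrow> real \<Rightarrow> 'a" where
  "control X s = - ((1 / lam) *\<^sub>R costate X s)"

definition running :: "(real \<Rightarrow> 'a) \<Rightarrow> real \<Rightarrow> real" where
  "running X s = (norm (costate X s))\<^sup>2 / (2 * lam) + F (X s)"

lemma control_continuous: "extremal x t X \<Longrightarrow> continuous_on {t..T} (control X)"
  unfolding control_def by (intro continuous_intros costate_continuous extremal_continuous)

lemma control_in_L2: "extremal x t X \<Longrightarrow> control X \<in> L2_controls t T"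
  by (intro continuous_on_L2_controls control_continuous)

lemma trajectory_control:
  assumes X: "extremal x t X" and s: "s \<in> {t..T}"
  shows "trajectory t y (control X) s = X s + (y - x)"
proof -
  have "costate X integrable_on {t..s}"
    using s by (intro costate_integrable[OF extremal_continuous[OF X]]) auto
  then have "integral {t..s} (control X) = - ((1 / lam) *\<^sub>R integral {t..s} (costate X))"
    unfolding control_def by (simp only: integral_neg integral_cmul)
  then show ?thesis
    unfolding trajectory_def using extremal_eq[OF X s] by simp
qed

lemma running_continuous: "extremal x t X \<Longrightarrow> continuous_on {t..T} (running X)"
  unfolding running_def using lam_pos
  by (intro continuous_intros costate_continuous F_comp_continuous extremal_continuous) auto

lemma running_integrable: "extremal x t X \<Longrightarrow> running X integrable_on {t..T}"
  by (intro integrable_continuous_real running_continuous)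

lemma norm_control: "lam / 2 * (norm (control X s))\<^sup>2 = (norm (costate X s))\<^sup>2 / (2 * lam)"
  using lam_pos by (simp add: control_def power_mult_distrib power_divide power2_eq_square)

lemma cost_control:
  assumes X: "extremal x t X" and t: "t \<in> {0..T}"
  shows "cost lam T F FT x t (control X) = integral {t..T} (running X) + FT (X T)"
proof -
  note cX = extremal_continuous[OF X]
  have "cost lam T F FT x t (control X) = lam / 2 * integral {t..T} (\<lambda>s. (norm (control X s))\<^sup>2)
      + integral {t..T} (\<lambda>s. F (X s)) + FT (X T)"
    by (rule cost_eq_integral(2)[OF t control_in_L2[OF X]]) (simp add: trajectory_control[OF X])
  also have "lam / 2 * integral {t..T} (\<lambda>s. (norm (control X s))\<^sup>2)
      = integral {t..T} (\<lambda>s. lam / 2 * (norm (control X s))\<^sup>2)"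
    by (rule Henstock_Kurzweil_Integration.integral_mult_right[symmetric])
  also have "\<dots> + integral {t..T} (\<lambda>s. F (X s)) = integral {t..T} (running X)"
    unfolding running_def norm_control[symmetric]
    by (rule integral_add[symmetric])
      (intro integrable_continuous_real continuous_intros control_continuous[OF X] F_comp_continuous cX)+
  finally show ?thesis .
qed

lemma integral_costate_inner:
  assumes X: "extremal x t X" and t: "t \<in> {0..T}"
    and h: "h integrable_on {t..T}" "(\<lambda>s. norm (h s)) integrable_on {t..T}"
    and Zh: "(\<lambda>s. costate X s \<bullet> h s) integrable_on {t..T}"
  shows "integral {t..T} (\<lambda>s. costate X s \<bullet> h s)
    = DFT (X T) \<bullet> integral {t..T} h + integral {t..T} (\<lambda>s. DF (X s) \<bullet> integral {t..s} h)"
  by (rule integration_by_parts_indefinite[OF _ _ h _ Zh])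
    (use t in \<open>auto simp: costate_def intro: DF_comp_continuous extremal_continuous[OF X]\<close>)

text \<open>
  Expand the cost at \<open>v = u + h\<close> around the extremal control \<open>u\<close>. The first order terms are
  \<open>\<lambda> \<integral>u \<bullet> h + \<integral>DF(X) \<bullet> Y + DF\<^sub>T(X(T)) \<bullet> Y(T)\<close>, which is zero by integration by parts since
  \<open>\<lambda> u = - Z\<close>. The errors of second order in \<open>F\<close> and \<open>F\<^sub>T\<close> are at most \<open>c T\<^sup>2 / 2\<close> and \<open>c T / 2\<close>
  times the integral of \<open>\<parallel>h\<parallel>\<^sup>2\<close>.
\<close>

lemma cost_quadratic_growth:
  assumes X: "extremal x t X" and t: "t \<in> {0..T}" and v: "v \<in> L2_controls t T"
  shows "cost lam T F FT x t (control X)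
      + (lam - c * T * (1 + T)) / 2 * integral {t..T} (\<lambda>s. (norm (v s - control X s))\<^sup>2)
    \<le> cost lam T F FT x t v"
proof -
  define u h where "u = control X" and "h s = v s - u s" for s
  define Y where "Y s = integral {t..s} h" for s
  note cX = extremal_continuous[OF X]
  have u: "u \<in> L2_controls t T" unfolding u_def by (rule control_in_L2[OF X])
  have hL: "h \<in> L2_controls t T" unfolding h_def by (rule L2_controls_diff[OF u v])
  note hi = L2_controls_integrable_on[OF hL]
  note ui = L2_controls_integrable_on[OF u] and vi = L2_controls_integrable_on[OF v]
  define I where "I = integral {t..T} (\<lambda>s. (norm (h s))\<^sup>2)"
  have traj: "trajectory t x v s = X s + Y s" if s: "s \<in> {t..T}" for s
  proof -
    have "v integrable_on {t..s}" "u integrable_on {t..s}"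
      using s by (auto intro: integral_subinterval(1)[OF vi(1)] integral_subinterval(1)[OF ui(1)])
    then have "trajectory t x v s = trajectory t x u s + Y s"
      unfolding Y_def h_def trajectory_def by (simp add: integral_diff)
    then show ?thesis using trajectory_control[OF X s, of x] by (simp add: u_def)
  qed
  have cY: "continuous_on {t..T} Y"
    unfolding Y_def by (intro indefinite_integral_continuous_1 hi)
  have Y_le: "(norm (Y s))\<^sup>2 \<le> T * I" if s: "s \<in> {t..T}" for s
  proof -
    have sub: "(\<lambda>r. norm (h r)) integrable_on {t..s}" "(\<lambda>r. (norm (h r))\<^sup>2) integrable_on {t..s}"
      "h integrable_on {t..s}"
      using s by (auto intro: integral_subinterval(1)[OF hi(1)] integral_subinterval(1)[OF hi(2)]
          integral_subinterval(1)[OF hi(3)])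
    have "norm (Y s) \<le> integral {t..s} (\<lambda>r. norm (h r))"
      unfolding Y_def by (rule integral_norm_bound_integral[OF sub(3) sub(1)]) simp
    then have "(norm (Y s))\<^sup>2 \<le> (integral {t..s} (\<lambda>r. norm (h r)))\<^sup>2"
      by (rule power_mono) simp
    also have "\<dots> \<le> (s - t) * integral {t..s} (\<lambda>r. (norm (h r))\<^sup>2)"
      by (rule square_integral_le[OF sub(1,2)]) (use s in auto)
    also have "\<dots> \<le> T * I"
    proof (rule mult_mono)
      show "integral {t..s} (\<lambda>r. (norm (h r))\<^sup>2) \<le> I"
        unfolding I_def using s by (intro integral_subset_le sub(2) hi(3)) auto
    qed (use s t sub in \<open>auto intro: integral_nonneg\<close>)
    finally show ?thesis .
  qed
  have "0 \<le> I" unfolding I_def by (intro integral_nonneg hi(3)) simp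
  define P where "P = integral {t..T} (\<lambda>s. DF (X s) \<bullet> Y s)"
  have intF: "(\<lambda>s. F (X s)) integrable_on {t..T}" and intFY: "(\<lambda>s. F (X s + Y s)) integrable_on {t..T}"
    and intP: "(\<lambda>s. DF (X s) \<bullet> Y s) integrable_on {t..T}"
    by (intro integrable_continuous_real F_comp_continuous continuous_intros DF_comp_continuous cX cY)+
  have "integral {t..T} (\<lambda>s. F (X s) + DF (X s) \<bullet> Y s - c / 2 * (T * I))
      \<le> integral {t..T} (\<lambda>s. F (X s + Y s))"
  proof (rule integral_le)
    fix s assume s: "s \<in> {t..T}"
    have "c / 2 * (norm (Y s))\<^sup>2 \<le> c / 2 * (T * I)"
      using Y_le[OF s] c_nonneg by (intro mult_left_mono) auto
    then show "F (X s) + DF (X s) \<bullet> Y s - c / 2 * (T * I) \<le> F (X s + Y s)"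
      using F_quadratic[of "X s" "Y s"] by linarith
  qed (intro integrable_diff integrable_add intF intFY intP integrable_const_ivl)+
  also have "integral {t..T} (\<lambda>s. F (X s) + DF (X s) \<bullet> Y s - c / 2 * (T * I))
      = integral {t..T} (\<lambda>s. F (X s)) + P - (T - t) * (c / 2 * (T * I))"
    unfolding P_def
    by (subst integral_diff[OF integrable_add[OF intF intP] integrable_const_ivl],
        subst integral_add[OF intF intP]) (use t in simp)
  finally have F_part: "integral {t..T} (\<lambda>s. F (X s)) + P - (T - t) * (c / 2 * (T * I))
      \<le> integral {t..T} (\<lambda>s. F (X s + Y s))" .
  have "(T - t) * (c / 2 * (T * I)) \<le> T * (c / 2 * (T * I))"
    using t c_nonneg T_pos \<open>0 \<le> I\<close> by (intro mult_right_mono) auto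
  with F_part have F_part': "integral {t..T} (\<lambda>s. F (X s)) + P - T * (c / 2 * (T * I))
      \<le> integral {t..T} (\<lambda>s. F (X s + Y s))" by linarith
  have "c / 2 * (norm (Y T))\<^sup>2 \<le> c / 2 * (T * I)"
    using Y_le[of T] t c_nonneg by (intro mult_left_mono) auto
  then have FT_part: "FT (X T) + DFT (X T) \<bullet> Y T - c / 2 * (T * I) \<le> FT (X T + Y T)"
    using FT_quadratic[of "X T" "Y T"] by linarith
  \<comment> \<open>The integrability of the mixed term comes for free from that of the three squares.\<close>
  have polar: "u s \<bullet> h s = ((norm (v s))\<^sup>2 - (norm (u s))\<^sup>2 - (norm (h s))\<^sup>2) / 2" for s
    by (simp add: h_def power2_norm_eq_inner algebra_simps inner_commute)
  have uh: "(\<lambda>s. u s \<bullet> h s) integrable_on {t..T}"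
    unfolding polar divide_inverse by (intro integrable_on_mult_left integrable_diff vi(3) ui(3) hi(3))
  have Zu: "costate X s \<bullet> h s = - lam * (u s \<bullet> h s)" for s
    using lam_pos by (simp add: u_def control_def)
  have "integral {t..T} (\<lambda>s. costate X s \<bullet> h s) = DFT (X T) \<bullet> Y T + P"
    unfolding Y_def P_def
    by (rule integral_costate_inner[OF X t hi(1,2)]) (unfold Zu, intro integrable_on_mult_right uh)
  then have grad: "- lam * integral {t..T} (\<lambda>s. u s \<bullet> h s) = DFT (X T) \<bullet> Y T + P"
    unfolding Zu by (simp only: Henstock_Kurzweil_Integration.integral_mult_right)
  have "integral {t..T} (\<lambda>s. (norm (v s))\<^sup>2)
      = integral {t..T} (\<lambda>s. (norm (u s))\<^sup>2 + 2 * (u s \<bullet> h s) + (norm (h s))\<^sup>2)"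
    by (rule integral_cong) (simp add: polar field_simps)
  also have "\<dots> = integral {t..T} (\<lambda>s. (norm (u s))\<^sup>2) + 2 * integral {t..T} (\<lambda>s. u s \<bullet> h s) + I"
    unfolding I_def
    by (simp add: integral_add integrable_add integrable_on_mult_right ui(3) uh hi(3))
  finally have v_part: "lam / 2 * integral {t..T} (\<lambda>s. (norm (v s))\<^sup>2)
      = lam / 2 * integral {t..T} (\<lambda>s. (norm (u s))\<^sup>2) + lam * integral {t..T} (\<lambda>s. u s \<bullet> h s) + lam / 2 * I"
    by (simp add: algebra_simps)
  have cv: "cost lam T F FT x t v = lam / 2 * integral {t..T} (\<lambda>s. (norm (v s))\<^sup>2)
      + integral {t..T} (\<lambda>s. F (X s + Y s)) + FT (X T + Y T)"
    by (rule cost_eq_integral(2)[OF t v traj])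
  have cu: "cost lam T F FT x t u = lam / 2 * integral {t..T} (\<lambda>s. (norm (u s))\<^sup>2)
      + integral {t..T} (\<lambda>s. F (X s)) + FT (X T)"
    by (rule cost_eq_integral(2)[OF t u]) (simp add: u_def trajectory_control[OF X])
  have "(lam - c * T * (1 + T)) / 2 * I = lam / 2 * I - T * (c / 2 * (T * I)) - c / 2 * (T * I)"
    by (simp add: field_simps)
  then have "cost lam T F FT x t u + (lam - c * T * (1 + T)) / 2 * I \<le> cost lam T F FT x t v"
    unfolding cu cv v_part using F_part' FT_part grad by linarith
  then show ?thesis by (simp add: u_def h_def I_def)
qed

lemma control_optimal:
  assumes X: "extremal x t X" and t: "t \<in> {0..T}"
  shows "optimal_control lam T F FT x t (control X)"
  unfolding optimal_control_def
proof (intro conjI ballI control_in_L2[OF X])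
  fix v :: "real \<Rightarrow> 'a" assume v: "v \<in> L2_controls t T"
  have "0 \<le> integral {t..T} (\<lambda>s. (norm (v s - control X s))\<^sup>2)"
    by (intro integral_nonneg L2_controls_integrable_on(3) L2_controls_diff v control_in_L2[OF X]) simp
  then have "0 \<le> (lam - c * T * (1 + T)) / 2 * integral {t..T} (\<lambda>s. (norm (v s - control X s))\<^sup>2)"
    using lam by (intro mult_nonneg_nonneg) auto
  then show "cost lam T F FT x t (control X) \<le> cost lam T F FT x t v"
    using cost_quadratic_growth[OF X t v] by linarith
qed

lemma optimal_control_unique:
  assumes X: "extremal x t X" and t: "t \<in> {0..T}" and v: "optimal_control lam T F FT x t v"
  shows "AE s in lebesgue_on {t..T}. v s = control X s"
proof -
  have vL: "v \<in> L2_controls t T" using v by (simp add: optimal_control_def)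
  define h where "h s = v s - control X s" for s
  have hL: "h \<in> L2_controls t T" unfolding h_def by (rule L2_controls_diff[OF control_in_L2[OF X] vL])
  have "cost lam T F FT x t v \<le> cost lam T F FT x t (control X)"
    using v control_in_L2[OF X] by (simp add: optimal_control_def)
  then have "(lam - c * T * (1 + T)) / 2 * integral {t..T} (\<lambda>s. (norm (h s))\<^sup>2) \<le> 0"
    using cost_quadratic_growth[OF X t vL] unfolding h_def by linarith
  then have "integral {t..T} (\<lambda>s. (norm (h s))\<^sup>2) \<le> 0"
    using lam by (simp add: mult_le_0_iff)
  moreover have "0 \<le> integral {t..T} (\<lambda>s. (norm (h s))\<^sup>2)"
    by (intro integral_nonneg L2_controls_integrable_on(3)[OF hL]) simp
  ultimately have "(LINT s|lebesgue_on {t..T}. (norm (h s))\<^sup>2) = 0"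
    using L2_controls_integrable_on(4)[OF hL] by simp
  moreover have "integrable (lebesgue_on {t..T}) (\<lambda>s. (norm (h s))\<^sup>2)"
    using hL by (simp add: L2_controls_def)
  ultimately have "AE s in lebesgue_on {t..T}. (norm (h s))\<^sup>2 = 0"
    using integral_nonneg_eq_0_iff_AE[of "lebesgue_on {t..T}" "\<lambda>s. (norm (h s))\<^sup>2"] by simp
  then show ?thesis by eventually_elim (simp add: h_def)
qed

section \<open>The gradient of the value function\<close>

abbreviation V :: "'a \<Rightarrow> real \<Rightarrow> real" where
  "V \<equiv> value_function lam T F FT"

lemma value_function_eq_cost:
  assumes X: "extremal x t X" and t: "t \<in> {0..T}"
  shows "V x t = cost lam T F FT x t (control X)"
  unfolding value_function_def
  using control_optimal[OF X t] unfolding optimal_control_def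
  by (intro cInf_eq_minimum) auto

lemma value_function_le_cost:
  assumes t: "t \<in> {0..T}" and v: "v \<in> L2_controls t T"
  shows "V x t \<le> cost lam T F FT x t v"
proof -
  obtain X where X: "extremal x t X" using extremal_exists[OF t] .
  show ?thesis
    unfolding value_function_eq_cost[OF X t]
    using control_optimal[OF X t] v unfolding optimal_control_def by blast
qed

lemma value_function_extremal:
  assumes X: "extremal x t X" and t: "t \<in> {0..T}"
  shows "V x t = integral {t..T} (running X) + FT (X T)"
  using value_function_eq_cost[OF assms] cost_control[OF assms] by simp

lemma value_function_terminal: "V x T = FT x"
proof -
  have T: "T \<in> {0..T}" using T_pos by simp
  obtain X where X: "extremal x T X" using extremal_exists[OF T] .
  show ?thesis using value_function_extremal[OF X T] extremal_initial[OF X T] by simp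
qed

text \<open>
  The control that is optimal at \<open>x\<close> is admissible at \<open>y\<close>, where it produces the translated state
  \<open>X + (y - x)\<close>.
\<close>

lemma value_function_upper:
  assumes X: "extremal x t X" and t: "t \<in> {0..T}"
  shows "V y t \<le> V x t + costate X t \<bullet> (y - x) + A / 2 * (norm (y - x))\<^sup>2"
proof -
  define d where "d = y - x"
  note cX = extremal_continuous[OF X]
  have cy: "cost lam T F FT y t (control X) = lam / 2 * integral {t..T} (\<lambda>s. (norm (control X s))\<^sup>2)
      + integral {t..T} (\<lambda>s. F (X s + d)) + FT (X T + d)"
    by (rule cost_eq_integral(2)[OF t control_in_L2[OF X]]) (simp add: trajectory_control[OF X] d_def)
  have cx: "cost lam T F FT x t (control X) = lam / 2 * integral {t..T} (\<lambda>s. (norm (control X s))\<^sup>2)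
      + integral {t..T} (\<lambda>s. F (X s)) + FT (X T)"
    by (rule cost_eq_integral(2)[OF t control_in_L2[OF X]]) (simp add: trajectory_control[OF X])
  have iDF: "(\<lambda>s. DF (X s)) integrable_on {t..T}" by (rule DF_comp_integrable[OF cX]) auto
  have intF: "(\<lambda>s. F (X s)) integrable_on {t..T}" and intFd: "(\<lambda>s. F (X s + d)) integrable_on {t..T}"
    and intD: "(\<lambda>s. DF (X s) \<bullet> d) integrable_on {t..T}"
    by (intro integrable_continuous_real F_comp_continuous continuous_intros DF_comp_continuous cX)+
  have "integral {t..T} (\<lambda>s. F (X s + d))
      \<le> integral {t..T} (\<lambda>s. F (X s) + DF (X s) \<bullet> d + c / 2 * (norm d)\<^sup>2)"
  proof (rule integral_le)
    show "F (X s + d) \<le> F (X s) + DF (X s) \<bullet> d + c / 2 * (norm d)\<^sup>2" for s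
      using F_quadratic[of "X s" d] by linarith
  qed (intro integrable_add intF intFd intD integrable_const_ivl)+
  also have "\<dots> = integral {t..T} (\<lambda>s. F (X s)) + integral {t..T} (\<lambda>s. DF (X s) \<bullet> d) + (T - t) * (c / 2 * (norm d)\<^sup>2)"
    by (subst integral_add[OF integrable_add[OF intF intD] integrable_const_ivl],
        subst integral_add[OF intF intD]) (use t in simp)
  also have "integral {t..T} (\<lambda>s. DF (X s) \<bullet> d) = integral {t..T} (\<lambda>s. DF (X s)) \<bullet> d"
    using integral_linear[OF iDF bounded_linear_inner_left[of d]] by (simp add: o_def)
  finally have 1: "integral {t..T} (\<lambda>s. F (X s + d)) \<le> integral {t..T} (\<lambda>s. F (X s))
      + integral {t..T} (\<lambda>s. DF (X s)) \<bullet> d + (T - t) * (c / 2 * (norm d)\<^sup>2)" .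
  have 2: "FT (X T + d) \<le> FT (X T) + DFT (X T) \<bullet> d + c / 2 * (norm d)\<^sup>2"
    using FT_quadratic[of "X T" d] by linarith
  have Z: "costate X t \<bullet> d = DFT (X T) \<bullet> d + integral {t..T} (\<lambda>s. DF (X s)) \<bullet> d"
    by (simp add: costate_def inner_add_left)
  have "(T - t) * (c / 2 * (norm d)\<^sup>2) + c / 2 * (norm d)\<^sup>2 = c * (1 + (T - t)) / 2 * (norm d)\<^sup>2"
    by (simp add: field_simps)
  also have "\<dots> \<le> A / 2 * (norm d)\<^sup>2"
  proof (intro mult_right_mono divide_right_mono)
    have "c * (1 + (T - t)) \<le> c * (1 + T)" using c_nonneg t by (intro mult_left_mono) auto
    then show "c * (1 + (T - t)) \<le> A" using A_ge(2) by linarith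
  qed auto
  finally have 3: "(T - t) * (c / 2 * (norm d)\<^sup>2) + c / 2 * (norm d)\<^sup>2 \<le> A / 2 * (norm d)\<^sup>2" .
  have "V y t \<le> cost lam T F FT y t (control X)"
    by (rule value_function_le_cost[OF t control_in_L2[OF X]])
  then show ?thesis
    unfolding value_function_eq_cost[OF X t] cx d_def[symmetric] using 1 2 3 Z cy by linarith
qed

text \<open>
  The lower bound is \<open>value_function_upper\<close> with \<open>x\<close> and \<open>y\<close> exchanged; replacing the costate at \<open>y\<close>
  by the one at \<open>x\<close> costs another \<open>A * (norm (y - x))\<^sup>2\<close>.
\<close>

lemma value_function_gradient_estimate:
  assumes X: "extremal x t X" and t: "t \<in> {0..T}"
  shows "\<bar>V y t - V x t - costate X t \<bullet> (y - x)\<bar> \<le> 2 * A * (norm (y - x))\<^sup>2"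
proof -
  obtain Y where Y: "extremal y t Y" using extremal_exists[OF t] .
  have up: "V y t - V x t - costate X t \<bullet> (y - x) \<le> A / 2 * (norm (y - x))\<^sup>2"
    using value_function_upper[OF X t, of y] by linarith
  have "V x t \<le> V y t + costate Y t \<bullet> (x - y) + A / 2 * (norm (x - y))\<^sup>2"
    by (rule value_function_upper[OF Y t])
  moreover have "costate Y t \<bullet> (x - y) = - (costate X t \<bullet> (y - x)) + (costate X t - costate Y t) \<bullet> (y - x)"
    by (simp add: algebra_simps)
  moreover have "(costate X t - costate Y t) \<bullet> (y - x) \<le> A * (norm (y - x))\<^sup>2"
  proof -
    have "(costate X t - costate Y t) \<bullet> (y - x) \<le> norm (costate X t - costate Y t) * norm (y - x)"
      by (rule norm_cauchy_schwarz)
    also have "\<dots> \<le> A * norm (x - y) * norm (y - x)"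
      by (intro mult_right_mono extremal_costate_lipschitz[OF X Y t]) (use t in auto)
    finally show ?thesis by (simp add: norm_minus_commute power2_eq_square mult.assoc)
  qed
  ultimately have low: "- (V y t - V x t - costate X t \<bullet> (y - x)) \<le> A * (norm (y - x))\<^sup>2 + A / 2 * (norm (y - x))\<^sup>2"
    by (simp add: norm_minus_commute)
  have "0 \<le> A * (norm (y - x))\<^sup>2" using A_nonneg by simp
  then show ?thesis using up low by (simp add: abs_le_iff)
qed

text \<open>
  Two extremals with the same initial state agree on \<open>{t..T}\<close>, so the values of \<open>state x t\<close> there do
  not depend on the choice. The formula for \<open>dV\<close> is the Bellman equation solved for the time derivative.
\<close>

definition state :: "'a \<Rightarrow> real \<Rightarrow> real \<Rightarrow> 'a" where
  "state x t = (SOME X. extremal x t X)"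

definition DV :: "'a \<Rightarrow> real \<Rightarrow> 'a" where
  "DV x t = costate (state x t) t"

definition dV :: "'a \<Rightarrow> real \<Rightarrow> real" where
  "dV x t = (norm (DV x t))\<^sup>2 / (2 * lam) - F x"

lemma state_extremal:
  assumes t: "t \<in> {0..T}"
  shows "extremal x t (state x t)"
proof -
  obtain X where "extremal x t X" using extremal_exists[OF t] .
  then show ?thesis unfolding state_def by (rule someI[of "extremal x t"])
qed

text \<open>
  The feedback form of the costate: from time \<open>s\<close> on, \<open>X\<close> is an extremal from \<open>(X s, s)\<close>, and the
  costate at \<open>s\<close> is the same for all such extremals.
\<close>

lemma costate_eq_DV:
  assumes X: "extremal x t X" and t: "t \<in> {0..T}" and s: "s \<in> {t..T}"
  shows "costate X s = DV (X s) s"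
proof -
  have s0: "s \<in> {0..T}" using t s by simp
  have "norm (costate X s - costate (state (X s) s) s) \<le> A * norm (X s - X s)"
    by (rule extremal_costate_lipschitz[OF extremal_restrict[OF X t s] state_extremal[OF s0] s0])
      (use s in simp)
  then show ?thesis by (simp add: DV_def)
qed

lemma DV_space: "t \<in> {0..T} \<Longrightarrow> norm (DV x t - DV y t) \<le> A * norm (x - y)"
  unfolding DV_def by (rule extremal_costate_lipschitz[OF state_extremal state_extremal]) auto

lemma DV_growth: "t \<in> {0..T} \<Longrightarrow> norm (DV x t) \<le> A * (1 + norm x)"
  unfolding DV_def by (rule extremal_costate_bound[OF state_extremal]) auto

text \<open>
  Follow the extremal from \<open>(x, t)\<close> up to time \<open>s\<close>: along it the gradient is the costate, which varies
  slowly, and the state \<open>X(s)\<close> reached is close to \<open>x\<close>, so that the Lipschitz bound in space applies.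
\<close>

lemma DV_time:
  assumes t: "t \<in> {0..T}" and s: "s \<in> {0..T}"
  shows "norm (DV x t - DV x s) \<le> (A + A * A / lam) * (1 + norm x) * \<bar>t - s\<bar>"
proof -
  have *: "norm (DV x s - DV x t) \<le> (A + A * A / lam) * (1 + norm x) * (s - t)"
    if t: "t \<in> {0..T}" and s: "s \<in> {t..T}" for t s
  proof -
    define X where "X = state x t"
    have X: "extremal x t X" unfolding X_def by (rule state_extremal[OF t])
    have Xt: "X t = x" by (rule extremal_initial[OF X t])
    have s0: "s \<in> {0..T}" using t s by simp
    have "norm (x - X s) \<le> A / lam * (1 + norm x) * (s - t)"
      using extremal_time(2)[OF X t, of t s] s Xt by (simp add: norm_minus_commute)
    then have "A * norm (x - X s) \<le> A * (A / lam * (1 + norm x) * (s - t))"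
      using A_nonneg by (rule mult_left_mono)
    then have 1: "norm (DV x s - DV (X s) s) \<le> A * (A / lam * (1 + norm x) * (s - t))"
      using DV_space[OF s0, of x "X s"] by linarith
    have 2: "norm (DV (X s) s - DV x t) \<le> A * (1 + norm x) * (s - t)"
      using extremal_costate_time[OF X t, of t s] s t costate_eq_DV[OF X t, of s] costate_eq_DV[OF X t, of t] Xt
      by simp
    have "norm (DV x s - DV x t) \<le> A * (A / lam * (1 + norm x) * (s - t)) + A * (1 + norm x) * (s - t)"
      using norm_triangle_mono[OF 1 2] by simp
    then show ?thesis by (simp add: algebra_simps)
  qed
  show ?thesis
    using *[of t s] *[of s t] t s by (cases "t \<le> s") (auto simp: norm_minus_commute abs_if)
qed

lemma value_function_gradient:
  assumes t: "t \<in> {0..T}"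
  shows "GDERIV (\<lambda>y. V y t) x :> DV x t"
  unfolding gderiv_def
proof (rule has_derivative_of_quadratic_error[OF bounded_linear_inner_left])
  show "norm (V y t - V x t - (y - x) \<bullet> DV x t) \<le> 2 * A * (norm (y - x))\<^sup>2" for y
    using value_function_gradient_estimate[OF state_extremal[OF t] t, of y x]
    by (simp add: DV_def inner_commute)
qed

section \<open>The time derivative of the value function\<close>

lemma dynamic_programming:
  assumes X: "extremal x t X" and t: "t \<in> {0..T}" and s: "s \<in> {t..T}"
  shows "V x t = integral {t..s} (running X) + V (X s) s"
proof -
  have s0: "s \<in> {0..T}" using t s by simp
  have "integral {t..T} (running X) - integral {s..T} (running X) = integral {t..s} (running X)"
    by (rule integral_subinterval(3)[OF running_integrable[OF X]]) (use s in auto)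
  then show ?thesis
    using value_function_extremal[OF X t] value_function_extremal[OF extremal_restrict[OF X t s] s0]
    by linarith
qed

text \<open>
  Of the factor 5, one part comes from the squared costate and four parts from \<open>F\<close> along \<open>X\<close>.
\<close>

lemma running_time:
  assumes X: "extremal x t X" and t: "t \<in> {0..T}" and r: "r \<in> {t..T}"
  shows "\<bar>running X r - running X t\<bar> \<le> 5 * A * A / lam * (1 + norm x)\<^sup>2 * (r - t)"
proof -
  define N where "N = 1 + norm x"
  have N: "1 \<le> N" by (simp add: N_def)
  have Xt: "X t = x" by (rule extremal_initial[OF X t])
  have tT: "t \<in> {t..T}" using t by simp
  have Z: "norm (costate X r) \<le> A * N" "norm (costate X t) \<le> A * N"
    "norm (costate X r - costate X t) \<le> A * N * (r - t)"
    using extremal_costate_bound[OF X t r] extremal_costate_bound[OF X t tT]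
      extremal_costate_time[OF X t, of t r] r by (auto simp: N_def)
  have "\<bar>(norm (costate X r))\<^sup>2 - (norm (costate X t))\<^sup>2\<bar> \<le> A * N * (r - t) * (A * N + A * N)"
    by (rule order_trans[OF power2_norm_diff_le mult_mono])
      (use Z add_mono[OF Z(1,2)] A_nonneg N r in auto)
  then have "\<bar>(norm (costate X r))\<^sup>2 - (norm (costate X t))\<^sup>2\<bar> / (2 * lam)
      \<le> A * N * (r - t) * (A * N + A * N) / (2 * lam)"
    using lam_pos by (intro divide_right_mono) auto
  moreover have "A * N * (r - t) * (A * N + A * N) / (2 * lam) = A * A / lam * N\<^sup>2 * (r - t)"
    using lam_pos by (simp add: field_simps power2_eq_square)
  moreover have "\<bar>(norm (costate X r))\<^sup>2 / (2 * lam) - (norm (costate X t))\<^sup>2 / (2 * lam)\<bar>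
      = \<bar>(norm (costate X r))\<^sup>2 - (norm (costate X t))\<^sup>2\<bar> / (2 * lam)"
    using lam_pos by (simp flip: diff_divide_distrib)
  ultimately have 1: "\<bar>(norm (costate X r))\<^sup>2 / (2 * lam) - (norm (costate X t))\<^sup>2 / (2 * lam)\<bar>
      \<le> A * A / lam * N\<^sup>2 * (r - t)" by linarith
  have "2 * c * (1 + norm x + norm (X r)) \<le> 2 * c * (2 * (1 + kappa) * N)"
  proof (intro mult_left_mono)
    show "1 + norm x + norm (X r) \<le> 2 * (1 + kappa) * N"
    proof -
      have "0 \<le> kappa * N" using kappa_pos N by simp
      moreover have "norm (X r) \<le> kappa * N" using extremal_bound[OF X t r] by (simp add: N_def)
      moreover have "2 * (1 + kappa) * N = 2 * N + 2 * (kappa * N)" by (simp add: algebra_simps)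
      moreover have "1 + norm x = N" by (simp add: N_def)
      ultimately show ?thesis using N by linarith
    qed
  qed (use c_nonneg in auto)
  also have "\<dots> \<le> 4 * A * N"
    using mult_right_mono[OF A_ge(3), of N] N by (simp add: algebra_simps)
  finally have P: "2 * c * (1 + norm x + norm (X r)) \<le> 4 * A * N" .
  have "norm (X r - x) \<le> A / lam * N * (r - t)"
    using extremal_time(2)[OF X t, of t r] r by (simp add: Xt N_def)
  then have "2 * c * (1 + norm x + norm (X r)) * norm (X r - x) \<le> 4 * A * N * (A / lam * N * (r - t))"
    by (rule mult_mono[OF P]) (use A_nonneg N in auto)
  then have 2: "\<bar>F (X r) - F x\<bar> \<le> 4 * A * N * (A / lam * N * (r - t))"
    using F_diff[of "X r" x] by linarith
  have "\<bar>running X r - running X t\<bar> \<le> A * A / lam * N\<^sup>2 * (r - t) + 4 * A * N * (A / lam * N * (r - t))"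
    using 1 2 unfolding running_def Xt by linarith
  also have "\<dots> = 5 * A * A / lam * N\<^sup>2 * (r - t)"
    using lam_pos by (simp add: power2_eq_square field_simps)
  finally show ?thesis by (simp only: N_def)
qed

text \<open>
  Write \<open>V(x, s) - V(x, t)\<close> as \<open>V(x, s) - V(X(s), s)\<close> minus the running cost on \<open>{t..s}\<close>. The first
  part is \<open>Z(s) \<bullet> (x - X(s))\<close> up to a quadratic error and \<open>x - X(s)\<close> is \<open>1 / \<lambda>\<close> times the integral of
  \<open>Z\<close>, so to first order it equals \<open>(s - t) \<parallel>Z(t)\<parallel>\<^sup>2 / \<lambda>\<close>. Half of this is compensated by the
  control cost.
\<close>

lemma value_function_forward_estimate:
  assumes t: "t \<in> {0..T}" and s: "s \<in> {t..T}"
  shows "\<bar>V x s - V x t - (s - t) * dV x t\<bar>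
    \<le> (2 * A * A * A / lam\<^sup>2 + 7 * A * A / lam) * (1 + norm x)\<^sup>2 * (s - t)\<^sup>2"
proof -
  define N \<Delta> where "N = 1 + norm x" and "\<Delta> = s - t"
  have N: "1 \<le> N" and \<Delta>: "0 \<le> \<Delta>" using s by (auto simp: N_def \<Delta>_def)
  define X where "X = state x t"
  have X: "extremal x t X" unfolding X_def by (rule state_extremal[OF t])
  note cX = extremal_continuous[OF X]
  have Xt: "X t = x" by (rule extremal_initial[OF X t])
  have s0: "s \<in> {0..T}" using t s by simp
  let ?Z = "costate X"
  have Zt: "?Z t = DV x t" using costate_eq_DV[OF X t, of t] Xt t by simp
  have xX: "x - X s = (1 / lam) *\<^sub>R integral {t..s} ?Z"
    using extremal_time(1)[OF X t, of t s] s Xt by simp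
  have Zi: "?Z integrable_on {t..s}" by (rule costate_integrable[OF cX]) (use s in auto)
  have Z: "norm (?Z r) \<le> A * N" if "r \<in> {t..s}" for r
    using extremal_costate_bound[OF X t, of r] that s by (simp add: N_def)
  have Zd: "norm (?Z r - ?Z t) \<le> A * N * \<Delta>" if r: "r \<in> {t..s}" for r
  proof -
    have "norm (?Z r - ?Z t) \<le> A * N * (r - t)"
      using extremal_costate_time[OF X t, of t r] r s by (simp add: N_def)
    also have "\<dots> \<le> A * N * \<Delta>"
      using r A_nonneg N by (intro mult_left_mono) (auto simp: \<Delta>_def)
    finally show ?thesis .
  qed
  \<comment> \<open>The three errors: linearising V in space, and freezing the costate and the running cost at time t.\<close>
  have e1: "\<bar>V x s - V (X s) s - ?Z s \<bullet> (x - X s)\<bar> \<le> 2 * A * (A / lam * N * \<Delta>)\<^sup>2"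
  proof -
    have "norm (x - X s) \<le> A / lam * N * \<Delta>"
      using extremal_time(2)[OF X t, of t s] s Xt by (simp add: norm_minus_commute N_def \<Delta>_def)
    then have "2 * A * (norm (x - X s))\<^sup>2 \<le> 2 * A * (A / lam * N * \<Delta>)\<^sup>2"
      using A_nonneg by (intro mult_left_mono power_mono) auto
    then show ?thesis
      using value_function_gradient_estimate[OF extremal_restrict[OF X t s] s0, of x] by linarith
  qed
  have Z2: "(\<lambda>r. ?Z s \<bullet> ?Z r) integrable_on {t..s}"
    "integral {t..s} (\<lambda>r. ?Z s \<bullet> ?Z r) = ?Z s \<bullet> integral {t..s} ?Z"
    using integrable_linear[OF Zi bounded_linear_inner_right[of "?Z s"]]
      integral_linear[OF Zi bounded_linear_inner_right[of "?Z s"]] by (auto simp: o_def)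
  have e2: "\<bar>?Z s \<bullet> integral {t..s} ?Z - \<Delta> * (?Z t \<bullet> ?Z t)\<bar> \<le> 2 * (A * N) * (A * N * \<Delta>) * \<Delta>"
  proof -
    have "norm (integral {t..s} (\<lambda>r. ?Z s \<bullet> ?Z r - ?Z t \<bullet> ?Z t)) \<le> 2 * (A * N) * (A * N * \<Delta>) * (s - t)"
    proof (rule integral_norm_le_const)
      show "(\<lambda>r. ?Z s \<bullet> ?Z r - ?Z t \<bullet> ?Z t) integrable_on {t..s}"
        by (intro integrable_diff Z2 integrable_const_ivl)
      fix r assume r: "r \<in> {t..s}"
      have "\<bar>(?Z s - ?Z t) \<bullet> ?Z r\<bar> \<le> A * N * \<Delta> * (A * N)"
        by (rule order_trans[OF Cauchy_Schwarz_ineq2 mult_mono])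
          (use r s Z Zd A_nonneg N \<Delta> in auto)
      moreover have "\<bar>?Z t \<bullet> (?Z r - ?Z t)\<bar> \<le> A * N * (A * N * \<Delta>)"
        by (rule order_trans[OF Cauchy_Schwarz_ineq2 mult_mono])
          (use r s Z Zd A_nonneg N \<Delta> in auto)
      moreover have "?Z s \<bullet> ?Z r - ?Z t \<bullet> ?Z t = (?Z s - ?Z t) \<bullet> ?Z r + ?Z t \<bullet> (?Z r - ?Z t)"
        by (simp add: algebra_simps)
      ultimately show "norm (?Z s \<bullet> ?Z r - ?Z t \<bullet> ?Z t) \<le> 2 * (A * N) * (A * N * \<Delta>)"
        unfolding real_norm_def by (simp add: algebra_simps)
    qed (use s in auto)
    moreover have "integral {t..s} (\<lambda>r. ?Z s \<bullet> ?Z r - ?Z t \<bullet> ?Z t)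
        = ?Z s \<bullet> integral {t..s} ?Z - \<Delta> * (?Z t \<bullet> ?Z t)"
      by (subst integral_diff[OF Z2(1) integrable_const_ivl]) (use s Z2(2) in \<open>simp add: \<Delta>_def\<close>)
    ultimately show ?thesis by (simp add: \<Delta>_def)
  qed
  have Ri: "running X integrable_on {t..s}"
    by (rule integral_subinterval(1)[OF running_integrable[OF X]]) (use s in auto)
  have e3: "\<bar>integral {t..s} (running X) - \<Delta> * running X t\<bar> \<le> 5 * A * A / lam * N\<^sup>2 * \<Delta> * \<Delta>"
  proof -
    have "norm (integral {t..s} (\<lambda>r. running X r - running X t)) \<le> 5 * A * A / lam * N\<^sup>2 * \<Delta> * (s - t)"
    proof (rule integral_norm_le_const)
      show "(\<lambda>r. running X r - running X t) integrable_on {t..s}"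
        by (intro integrable_diff Ri integrable_const_ivl)
      fix r assume r: "r \<in> {t..s}"
      have "\<bar>running X r - running X t\<bar> \<le> 5 * A * A / lam * N\<^sup>2 * (r - t)"
        using running_time[OF X t, of r] r s by (simp add: N_def)
      also have "\<dots> \<le> 5 * A * A / lam * N\<^sup>2 * \<Delta>"
        using r A_nonneg lam_pos by (intro mult_left_mono) (auto simp: \<Delta>_def)
      finally show "norm (running X r - running X t) \<le> 5 * A * A / lam * N\<^sup>2 * \<Delta>" by simp
    qed (use s in auto)
    moreover have "integral {t..s} (\<lambda>r. running X r - running X t)
        = integral {t..s} (running X) - \<Delta> * running X t"
      by (subst integral_diff[OF Ri integrable_const_ivl]) (use s in \<open>simp add: \<Delta>_def\<close>)
    ultimately show ?thesis by (simp add: \<Delta>_def)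
  qed
  define a b where "a = ?Z s \<bullet> integral {t..s} ?Z - \<Delta> * (?Z t \<bullet> ?Z t)"
    and "b = integral {t..s} (running X) - \<Delta> * running X t"
  have "V x s - V x t - \<Delta> * dV x t
      = (V x s - V (X s) s - ?Z s \<bullet> (x - X s)) + (1 / lam) * a - b"
  proof -
    have "?Z s \<bullet> (x - X s) = (1 / lam) * a + \<Delta> * ((?Z t \<bullet> ?Z t) / lam)"
      unfolding xX a_def by (simp add: diff_divide_distrib)
    moreover have "running X t = (?Z t \<bullet> ?Z t) / (2 * lam) + F x"
      unfolding running_def Xt by (simp add: power2_norm_eq_inner)
    moreover have "dV x t = (?Z t \<bullet> ?Z t) / (2 * lam) - F x"
      by (simp add: dV_def Zt power2_norm_eq_inner)
    moreover have "V x t = b + \<Delta> * running X t + V (X s) s"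
      using dynamic_programming[OF X t s] by (simp add: b_def)
    moreover have "\<Delta> * ((?Z t \<bullet> ?Z t) / lam) = \<Delta> * ((?Z t \<bullet> ?Z t) / (2 * lam)) + \<Delta> * ((?Z t \<bullet> ?Z t) / (2 * lam))"
      using lam_pos by (simp add: field_simps)
    ultimately show ?thesis by (simp only: distrib_left right_diff_distrib)
  qed
  moreover have "\<bar>(1 / lam) * a\<bar> \<le> (1 / lam) * (2 * (A * N) * (A * N * \<Delta>) * \<Delta>)"
    unfolding abs_mult using e2 lam_pos by (intro mult_mono) (auto simp: a_def)
  ultimately have "\<bar>V x s - V x t - \<Delta> * dV x t\<bar> \<le> 2 * A * (A / lam * N * \<Delta>)\<^sup>2
      + (1 / lam) * (2 * (A * N) * (A * N * \<Delta>) * \<Delta>) + 5 * A * A / lam * N\<^sup>2 * \<Delta> * \<Delta>"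
    using e1 e3 unfolding b_def by linarith
  also have "\<dots> = (2 * A * A * A / lam\<^sup>2 + 7 * A * A / lam) * N\<^sup>2 * \<Delta>\<^sup>2"
    using lam_pos by (simp add: field_simps power2_eq_square)
  finally show ?thesis by (simp only: N_def \<Delta>_def)
qed

section \<open>Regularity and growth of the value function\<close>

text \<open>
  The constants in the time modulus of \<open>DV\<close>, and in the space and time moduli of \<open>dV\<close>.
\<close>

definition B :: real where "B = A + A * A / lam"

definition Lx :: real where "Lx = A * A / lam + 2 * c"

definition Lt :: real where "Lt = 3 * A * B / lam"

lemma const_nonneg: "A \<le> B" "0 \<le> B" "0 \<le> Lx" "0 \<le> Lt"
  using A_nonneg c_nonneg lam_pos by (auto simp: B_def Lx_def Lt_def)

lemma DV_lipschitz:
  assumes t: "t \<in> {0..T}" and s: "s \<in> {0..T}"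
  shows "norm (DV x t - DV y s) \<le> A * norm (x - y) + B * \<bar>t - s\<bar> * (1 + norm x + norm y)"
proof -
  have "norm (DV y t - DV y s) \<le> B * (1 + norm y) * \<bar>t - s\<bar>"
    using DV_time[OF t s] by (simp add: B_def)
  also have "\<dots> \<le> B * (1 + norm x + norm y) * \<bar>t - s\<bar>"
    using const_nonneg by (intro mult_right_mono mult_left_mono) auto
  finally have 2: "norm (DV y t - DV y s) \<le> B * \<bar>t - s\<bar> * (1 + norm x + norm y)"
    by (simp only: mult_ac)
  show ?thesis using norm_triangle_mono[OF DV_space[OF t, of x y] 2] by simp
qed

lemma dV_lipschitz:
  assumes t: "t \<in> {0..T}" and s: "s \<in> {0..T}"
  shows "\<bar>dV x t - dV y s\<bar> \<le> Lx * norm (x - y) * (1 + norm x + norm y)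
    + Lt * \<bar>t - s\<bar> * (1 + (norm x)\<^sup>2 + (norm y)\<^sup>2)"
proof -
  define M d \<tau> where "M = 1 + norm x + norm y" and "d = norm (x - y)" and "\<tau> = \<bar>t - s\<bar>"
  have nn: "1 \<le> M" "0 \<le> d" "0 \<le> \<tau>" by (auto simp: M_def d_def \<tau>_def)
  have D: "norm (DV x t - DV y s) \<le> A * d + B * \<tau> * M"
    using DV_lipschitz[OF t s] by (simp add: M_def d_def \<tau>_def)
  have "norm (DV x t) + norm (DV y s) \<le> A * (1 + norm x) + A * (1 + norm y)"
    using DV_growth[OF t] DV_growth[OF s] by (rule add_mono)
  also have "\<dots> = A * ((1 + norm x) + (1 + norm y))" by (simp only: distrib_left)
  also have "\<dots> \<le> A * (2 * M)"
    using A_nonneg by (intro mult_left_mono) (auto simp: M_def)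
  finally have S: "norm (DV x t) + norm (DV y s) \<le> A * (2 * M)" .
  have "\<bar>(norm (DV x t))\<^sup>2 - (norm (DV y s))\<^sup>2\<bar> \<le> (A * d + B * \<tau> * M) * (A * (2 * M))"
    by (rule order_trans[OF power2_norm_diff_le mult_mono[OF D S]])
      (use nn A_nonneg const_nonneg in auto)
  then have "\<bar>(norm (DV x t))\<^sup>2 - (norm (DV y s))\<^sup>2\<bar> / (2 * lam) \<le> (A * d + B * \<tau> * M) * (A * (2 * M)) / (2 * lam)"
    using lam_pos by (intro divide_right_mono) auto
  moreover have "(A * d + B * \<tau> * M) * (A * (2 * M)) / (2 * lam) = A * A / lam * d * M + A * B / lam * \<tau> * M\<^sup>2"
    using lam_pos by (simp add: field_simps power2_eq_square)
  moreover have "A * B / lam * \<tau> * M\<^sup>2 \<le> A * B / lam * \<tau> * (3 * (1 + (norm x)\<^sup>2 + (norm y)\<^sup>2))"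
    unfolding M_def using A_nonneg const_nonneg lam_pos nn by (intro mult_left_mono square_sum_le) auto
  moreover have "\<bar>(norm (DV x t))\<^sup>2 / (2 * lam) - (norm (DV y s))\<^sup>2 / (2 * lam)\<bar>
      = \<bar>(norm (DV x t))\<^sup>2 - (norm (DV y s))\<^sup>2\<bar> / (2 * lam)"
    using lam_pos by (simp flip: diff_divide_distrib)
  moreover have "\<bar>F x - F y\<bar> \<le> 2 * c * d * M"
  proof -
    have "2 * c * (1 + norm y + norm x) * norm (x - y) = 2 * c * d * M"
      by (simp add: M_def d_def algebra_simps)
    then show ?thesis using F_diff[of x y] by linarith
  qed
  ultimately have "\<bar>dV x t - dV y s\<bar> \<le> A * A / lam * d * M
      + A * B / lam * \<tau> * (3 * (1 + (norm x)\<^sup>2 + (norm y)\<^sup>2)) + 2 * c * d * M"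
    unfolding dV_def by linarith
  also have "\<dots> = Lx * d * M + Lt * \<tau> * (1 + (norm x)\<^sup>2 + (norm y)\<^sup>2)"
    by (simp add: Lx_def Lt_def algebra_simps add_divide_distrib)
  finally show ?thesis by (simp only: M_def d_def \<tau>_def)
qed

lemma value_function_lipschitz_bounds: "lipschitz_bounds T DV dV"
  unfolding lipschitz_bounds_def
proof (rule exI[of _ "B + Lx + Lt"], intro allI ballI conjI)
  fix x y :: 'a and t s :: real assume t: "t \<in> {0..T}" and s: "s \<in> {0..T}"
  define C where "C = B + Lx + Lt"
  have C: "A \<le> C" "B \<le> C" "Lx \<le> C" "Lt \<le> C" using const_nonneg by (auto simp: C_def)
  have "A * norm (x - y) + B * \<bar>t - s\<bar> * (1 + norm x + norm y)
      \<le> C * norm (x - y) + C * \<bar>t - s\<bar> * (1 + norm x + norm y)"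
    by (intro add_mono mult_right_mono C) auto
  then show "norm (DV x t - DV y s) \<le> C * norm (x - y) + C * \<bar>t - s\<bar> * (1 + norm x + norm y)"
    using DV_lipschitz[OF t s, of x y] by linarith
  have "Lx * norm (x - y) * (1 + norm x + norm y) + Lt * \<bar>t - s\<bar> * (1 + (norm x)\<^sup>2 + (norm y)\<^sup>2)
      \<le> C * norm (x - y) * (1 + norm x + norm y) + C * \<bar>t - s\<bar> * (1 + (norm x)\<^sup>2 + (norm y)\<^sup>2)"
    by (intro add_mono mult_right_mono C) auto
  then show "\<bar>dV x t - dV y s\<bar> \<le> C * norm (x - y) * (1 + norm x + norm y)
      + C * \<bar>t - s\<bar> * (1 + (norm x)\<^sup>2 + (norm y)\<^sup>2)"
    using dV_lipschitz[OF t s, of x y] by linarith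
qed

text \<open>
  The forward estimate covers \<open>t \<le> s\<close>. For \<open>s < t\<close> it is applied from \<open>s\<close>, and the slope \<open>dV x s\<close> is
  exchanged for \<open>dV x t\<close> by the Lipschitz bound, at the price of another quadratic error.
\<close>

lemma value_function_time_derivative:
  assumes t: "t \<in> {0..T}"
  shows "((\<lambda>s. V x s) has_real_derivative dV x t) (at t within {0..T})"
  unfolding has_field_derivative_def
proof (rule has_derivative_of_quadratic_error[OF bounded_linear_mult_right])
  define K where "K = (2 * A * A * A / lam\<^sup>2 + 7 * A * A / lam) * (1 + norm x)\<^sup>2"
  define L where "L = Lt * (1 + (norm x)\<^sup>2 + (norm x)\<^sup>2)"
  have "0 \<le> L" using const_nonneg by (simp add: L_def)
  fix s assume s: "s \<in> {0..T}"
  have "\<bar>V x s - V x t - (s - t) * dV x t\<bar> \<le> (K + L) * (s - t)\<^sup>2"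
  proof (cases "t \<le> s")
    case True
    then have "\<bar>V x s - V x t - (s - t) * dV x t\<bar> \<le> K * (s - t)\<^sup>2"
      using value_function_forward_estimate[OF t, of s x] s by (simp add: K_def)
    moreover have "0 \<le> L * (s - t)\<^sup>2" using \<open>0 \<le> L\<close> by simp
    ultimately show ?thesis by (simp add: distrib_right)
  next
    case False
    then have 1: "\<bar>V x t - V x s - (t - s) * dV x s\<bar> \<le> K * (t - s)\<^sup>2"
      using value_function_forward_estimate[OF s, of t x] t by (simp add: K_def)
    have "\<bar>dV x s - dV x t\<bar> \<le> L * (t - s)"
      using dV_lipschitz[OF s t, of x x] False by (simp add: L_def mult_ac)
    then have "(t - s) * \<bar>dV x s - dV x t\<bar> \<le> (t - s) * (L * (t - s))"
      using False by (intro mult_left_mono) auto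
    then have 2: "\<bar>(t - s) * (dV x s - dV x t)\<bar> \<le> L * (t - s)\<^sup>2"
      using False by (simp add: abs_mult power2_eq_square mult_ac)
    have "V x s - V x t - (s - t) * dV x t
        = - (V x t - V x s - (t - s) * dV x s) - (t - s) * (dV x s - dV x t)"
      by (simp add: algebra_simps)
    then have "\<bar>V x s - V x t - (s - t) * dV x t\<bar> \<le> K * (t - s)\<^sup>2 + L * (t - s)\<^sup>2"
      using 1 2 by linarith
    then show ?thesis by (simp add: distrib_right power2_commute)
  qed
  then show "norm (V x s - V x t - dV x t * (s - t)) \<le> (K + L) * (norm (s - t))\<^sup>2"
    by (simp add: mult.commute)
qed

lemma value_function_C1: "C1_on_strip T V DV dV"
proof -
  obtain C where "\<And>x y t s. t \<in> {0..T} \<Longrightarrow> s \<in> {0..T} \<Longrightarrow>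
      norm (DV x t - DV y s) \<le> C * norm (x - y) + C * \<bar>t - s\<bar> * (1 + norm x + norm y)"
    using value_function_lipschitz_bounds unfolding lipschitz_bounds_def by blast
  then have cD: "continuous_on (UNIV \<times> {0..T}) (\<lambda>(x, t). DV x t)"
    by (rule continuous_on_strip_of_lipschitz)
  then have cD': "continuous_on (UNIV \<times> {0..T}) (\<lambda>p. DV (fst p) (snd p))"
    by (simp add: split_beta)
  have "continuous_on (UNIV \<times> {0..T}) (\<lambda>p. dV (fst p) (snd p))"
    unfolding dV_def using lam_pos
    by (intro continuous_intros cD' F_comp_continuous) auto
  then have "continuous_on (UNIV \<times> {0..T}) (\<lambda>(x, t). dV x t)"
    by (simp add: split_beta)
  with cD show ?thesis
    unfolding C1_on_strip_def using value_function_gradient value_function_time_derivative by blast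
qed

lemma quadratic_growth:
  assumes "\<And>h. \<bar>G (0 + h) - G 0 - DG \<bullet> h\<bar> \<le> c / 2 * (norm h)\<^sup>2" and DG: "norm DG \<le> c"
  shows "\<bar>G x\<bar> \<le> (\<bar>G 0\<bar> + 2 * c) * (1 + (norm x)\<^sup>2)"
proof -
  have "\<bar>G x - G 0 - DG \<bullet> x\<bar> \<le> c / 2 * (norm x)\<^sup>2" using assms(1)[of x] by simp
  moreover have "\<bar>DG \<bullet> x\<bar> \<le> c * norm x"
    by (rule order_trans[OF Cauchy_Schwarz_ineq2 mult_right_mono[OF DG]]) simp
  moreover have "c * norm x \<le> c * (1 + (norm x)\<^sup>2)"
  proof (rule mult_left_mono[OF _ c_nonneg])
    have "0 \<le> (1 - norm x)\<^sup>2" by simp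
    then have "2 * norm x \<le> 1 + (norm x)\<^sup>2" by (simp add: power2_diff)
    then show "norm x \<le> 1 + (norm x)\<^sup>2" using norm_ge_zero[of x] by linarith
  qed
  moreover have "c / 2 * (norm x)\<^sup>2 \<le> c * (1 + (norm x)\<^sup>2)"
    using c_nonneg by (intro mult_mono) auto
  moreover have "\<bar>G 0\<bar> * 1 \<le> \<bar>G 0\<bar> * (1 + (norm x)\<^sup>2)" by (intro mult_left_mono) auto
  ultimately have "\<bar>G x\<bar> \<le> \<bar>G 0\<bar> * (1 + (norm x)\<^sup>2) + c * (1 + (norm x)\<^sup>2) + c * (1 + (norm x)\<^sup>2)"
    by linarith
  then show ?thesis by (simp add: distrib_right)
qed

text \<open>
  The bound on \<open>V\<close> itself follows from that on its time derivative, by integration backwards from the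
  terminal value \<open>FT x\<close>.
\<close>

lemma value_function_growth_bounds: "growth_bounds T V DV dV"
proof -
  define K where "K = A * A / lam + (\<bar>F 0\<bar> + 2 * c)"
  define J where "J = \<bar>FT 0\<bar> + 2 * c"
  have nn: "0 \<le> K" "0 \<le> J" using A_nonneg lam_pos c_nonneg by (auto simp: K_def J_def)
  have dV_le: "\<bar>dV x t\<bar> \<le> K * (1 + (norm x)\<^sup>2)" if t: "t \<in> {0..T}" for x t
  proof -
    have "(norm (DV x t))\<^sup>2 \<le> (A * (1 + norm x))\<^sup>2"
      by (rule power_mono[OF DV_growth[OF t]]) simp
    also have "\<dots> = A * A * (1 + norm x)\<^sup>2" by (simp add: power_mult_distrib power2_eq_square)
    also have "\<dots> \<le> A * A * (2 * (1 + (norm x)\<^sup>2))"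
      using A_nonneg by (intro mult_left_mono square_sum_le) auto
    finally have "(norm (DV x t))\<^sup>2 / (2 * lam) \<le> A * A * (2 * (1 + (norm x)\<^sup>2)) / (2 * lam)"
      using lam_pos by (intro divide_right_mono) auto
    also have "\<dots> = A * A / lam * (1 + (norm x)\<^sup>2)" using lam_pos by (simp add: field_simps)
    finally have 1: "(norm (DV x t))\<^sup>2 / (2 * lam) \<le> A * A / lam * (1 + (norm x)\<^sup>2)" .
    have 2: "\<bar>F x\<bar> \<le> (\<bar>F 0\<bar> + 2 * c) * (1 + (norm x)\<^sup>2)"
      by (rule quadratic_growth[OF F_quadratic F_0])
    have 3: "0 \<le> (norm (DV x t))\<^sup>2 / (2 * lam)" using lam_pos by simp
    have "\<bar>dV x t\<bar> \<le> A * A / lam * (1 + (norm x)\<^sup>2) + (\<bar>F 0\<bar> + 2 * c) * (1 + (norm x)\<^sup>2)"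
      unfolding dV_def using 1 2 3 by linarith
    then show ?thesis by (simp only: K_def distrib_right)
  qed
  have V_le: "\<bar>V x t\<bar> \<le> (K * T + J) * (1 + (norm x)\<^sup>2)" if t: "t \<in> {0..T}" for x t
  proof -
    have "norm (V x t - V x T) \<le> K * (1 + (norm x)\<^sup>2) * norm (t - T)"
    proof (rule field_differentiable_bound[of "{0..T}" "\<lambda>s. V x s" "\<lambda>s. dV x s"])
      show "((\<lambda>s. V x s) has_field_derivative dV x s) (at s within {0..T})" if "s \<in> {0..T}" for s
        by (rule value_function_time_derivative[OF that])
      show "norm (dV x s) \<le> K * (1 + (norm x)\<^sup>2)" if "s \<in> {0..T}" for s
        using dV_le[OF that] by simp
    qed (use t in auto)
    also have "\<dots> \<le> K * (1 + (norm x)\<^sup>2) * T"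
      using t nn by (intro mult_left_mono) auto
    finally have "\<bar>V x t - FT x\<bar> \<le> K * (1 + (norm x)\<^sup>2) * T"
      by (simp add: value_function_terminal)
    moreover have "\<bar>FT x\<bar> \<le> J * (1 + (norm x)\<^sup>2)"
      unfolding J_def by (rule quadratic_growth[OF FT_quadratic FT_0])
    ultimately have "\<bar>V x t\<bar> \<le> K * (1 + (norm x)\<^sup>2) * T + J * (1 + (norm x)\<^sup>2)" by linarith
    then show ?thesis by (simp add: algebra_simps)
  qed
  define C where "C = K * T + J + A + K"
  have "0 \<le> K * T" using nn T_pos by simp
  then have C: "K * T + J \<le> C" "A \<le> C" "K \<le> C"
    using nn A_nonneg by (auto simp: C_def)
  show ?thesis
    unfolding growth_bounds_def
  proof (rule exI[of _ C], intro allI ballI conjI)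
    fix x :: 'a and t :: real assume t: "t \<in> {0..T}"
    show "\<bar>V x t\<bar> \<le> C * (1 + (norm x)\<^sup>2)"
      by (rule order_trans[OF V_le[OF t] mult_right_mono[OF C(1)]]) simp
    show "norm (DV x t) \<le> C * (1 + norm x)"
      by (rule order_trans[OF DV_growth[OF t] mult_right_mono[OF C(2)]]) simp
    show "\<bar>dV x t\<bar> \<le> C * (1 + (norm x)\<^sup>2)"
      by (rule order_trans[OF dV_le[OF t] mult_right_mono[OF C(3)]]) simp
  qed
qed

lemma value_function_bellman: "bellman_solution lam T F FT V DV dV"
  unfolding bellman_solution_def by (simp add: dV_def value_function_terminal)

section \<open>Uniqueness for the Bellman equation\<close>

text \<open>
  The chain rule along the trajectory, with the time derivative eliminated by the Bellman equation,
  leaves a complete square in the control. Only continuous controls are considered, because their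
  trajectories are continuously differentiable.
\<close>

lemma verification:
  assumes C1: "C1_on_strip T W DW dW" and bellman: "bellman_solution lam T F FT W DW dW"
    and t: "t \<in> {0..T}" and v: "continuous_on {t..T} v"
    and X: "\<And>s. s \<in> {t..T} \<Longrightarrow> X s = x + integral {t..s} v"
  shows "cost lam T F FT x t v
    = W x t + lam / 2 * integral {t..T} (\<lambda>s. (norm (v s + (1 / lam) *\<^sub>R DW (X s) s))\<^sup>2)"
proof -
  have vL: "v \<in> L2_controls t T" by (rule continuous_on_L2_controls[OF v])
  have traj: "trajectory t x v s = X s" if "s \<in> {t..T}" for s
    using X[OF that] by (simp add: trajectory_def)
  note cX = cost_eq_integral(1)[OF t vL traj] and cost = cost_eq_integral(2)[OF t vL traj]
  have cDW: "continuous_on {t..T} (\<lambda>s. DW (X s) s)"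
  proof -
    have "continuous_on (UNIV \<times> {0..T}) (\<lambda>(x, t). DW x t)"
      using C1 by (simp add: C1_on_strip_def)
    then have "continuous_on {t..T} (\<lambda>s. (\<lambda>(x, t). DW x t) (X s, s))"
      by (rule continuous_on_compose2) (use t in \<open>auto intro!: continuous_intros cX\<close>)
    then show ?thesis by simp
  qed
  have "((\<lambda>s. W (X s) s) has_vector_derivative (v s \<bullet> DW (X s) s + dW (X s) s)) (at s within {t..T})"
    if s: "s \<in> {t..T}" for s
  proof -
    have "((\<lambda>s. x + integral {t..s} v) has_vector_derivative v s) (at s within {t..T})"
      using integral_has_vector_derivative[OF v s] by (auto intro!: derivative_eq_intros)
    then have "(X has_vector_derivative v s) (at s within {t..T})"
      by (rule has_vector_derivative_transform[OF s, rotated]) (simp add: X)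
    then have g: "((\<lambda>s. (X s, s)) has_derivative (\<lambda>r. (r *\<^sub>R v s, r))) (at s within {t..T})"
      unfolding has_vector_derivative_def by (auto intro!: derivative_eq_intros)
    have "((\<lambda>(y, s). W y s) has_derivative (\<lambda>(h, r). h \<bullet> DW (X s) s + r * dW (X s) s))
        (at (X s, s) within (\<lambda>s. (X s, s)) ` {t..T})"
      by (rule has_derivative_subset[where s = "UNIV \<times> {0..T}"])
        (use C1 s t in \<open>auto simp: C1_on_strip_iff_has_derivative\<close>)
    from diff_chain_within[OF g this] show ?thesis
      unfolding has_vector_derivative_def
      by (simp add: o_def algebra_simps)
  qed
  then have "((\<lambda>s. v s \<bullet> DW (X s) s + dW (X s) s) has_integral (W (X T) T - W (X t) t)) {t..T}"
    using t by (intro fundamental_theorem_of_calculus) auto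
  then have ftc: "integral {t..T} (\<lambda>s. v s \<bullet> DW (X s) s + dW (X s) s) = FT (X T) - W x t"
    using bellman X[of t] t by (simp add: integral_unique bellman_solution_def)
  have square: "lam / 2 * (norm (v s + (1 / lam) *\<^sub>R DW (X s) s))\<^sup>2
      = (v s \<bullet> DW (X s) s + dW (X s) s) + (lam / 2 * (norm (v s))\<^sup>2 + F (X s))" if s: "s \<in> {t..T}" for s
  proof -
    have "dW (X s) s = (norm (DW (X s) s))\<^sup>2 / (2 * lam) - F (X s)"
      using bellman s t unfolding bellman_solution_def by (auto simp: algebra_simps)
    moreover have "lam / 2 * (norm (v s + (1 / lam) *\<^sub>R DW (X s) s))\<^sup>2
        = v s \<bullet> DW (X s) s + (norm (DW (X s) s))\<^sup>2 / (2 * lam) + lam / 2 * (norm (v s))\<^sup>2"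
      unfolding power2_norm_eq_inner inner_add_left inner_add_right inner_scaleR_left inner_scaleR_right
        inner_commute[of "DW (X s) s" "v s"]
      using lam_pos by (simp add: field_simps)
    ultimately show ?thesis by linarith
  qed
  have i1: "(\<lambda>s. v s \<bullet> DW (X s) s + dW (X s) s) integrable_on {t..T}"
    using \<open>(_ has_integral (W (X T) T - W (X t) t)) _\<close> by blast
  have i2: "(\<lambda>s. lam / 2 * (norm (v s))\<^sup>2) integrable_on {t..T}" "(\<lambda>s. F (X s)) integrable_on {t..T}"
    by (intro integrable_continuous_real continuous_intros v F_comp_continuous cX)+
  have "lam / 2 * integral {t..T} (\<lambda>s. (norm (v s + (1 / lam) *\<^sub>R DW (X s) s))\<^sup>2)
      = integral {t..T} (\<lambda>s. lam / 2 * (norm (v s + (1 / lam) *\<^sub>R DW (X s) s))\<^sup>2)"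
    by (rule Henstock_Kurzweil_Integration.integral_mult_right[symmetric])
  also have "\<dots> = integral {t..T} (\<lambda>s. (v s \<bullet> DW (X s) s + dW (X s) s) + (lam / 2 * (norm (v s))\<^sup>2 + F (X s)))"
    by (rule integral_cong) (rule square)
  also have "\<dots> = integral {t..T} (\<lambda>s. v s \<bullet> DW (X s) s + dW (X s) s)
      + (integral {t..T} (\<lambda>s. lam / 2 * (norm (v s))\<^sup>2) + integral {t..T} (\<lambda>s. F (X s)))"
    by (subst integral_add[OF i1 integrable_add[OF i2]], subst integral_add[OF i2]) simp
  also have "integral {t..T} (\<lambda>s. lam / 2 * (norm (v s))\<^sup>2) = lam / 2 * integral {t..T} (\<lambda>s. (norm (v s))\<^sup>2)"
    by (rule Henstock_Kurzweil_Integration.integral_mult_right)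
  finally show ?thesis using cost ftc by linarith
qed

text \<open>
  For the extremal control the cost in \<open>verification\<close> is \<open>V x t\<close>, and the integral of the square is
  nonnegative. For the feedback control the square is zero, and the cost is at least \<open>V x t\<close>.
\<close>

lemma bellman_solution_unique:
  assumes C1: "C1_on_strip T W DW dW" and bellman: "bellman_solution lam T F FT W DW dW"
    and lip: "lipschitz_bounds T DW dW" and t: "t \<in> {0..T}"
  shows "W x t = V x t"
proof (rule antisym)
  show "W x t \<le> V x t"
  proof -
    define X where "X = state x t"
    have X: "extremal x t X" unfolding X_def by (rule state_extremal[OF t])
    note cX = extremal_continuous[OF X]
    \<comment> \<open>The feedback defect of the extremal control, whose weighted square is the gap between V and W.\<close>
    let ?D = "\<lambda>s. control X s + (1 / lam) *\<^sub>R DW (X s) s"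
    have "cost lam T F FT x t (control X) = W x t + lam / 2 * integral {t..T} (\<lambda>s. (norm (?D s))\<^sup>2)"
      by (rule verification[OF C1 bellman t control_continuous[OF X]])
        (use trajectory_control[OF X, of _ x] in \<open>simp add: trajectory_def\<close>)
    moreover have "0 \<le> integral {t..T} (\<lambda>s. (norm (?D s))\<^sup>2)"
      by (cases "(\<lambda>s. (norm (?D s))\<^sup>2) integrable_on {t..T}")
        (auto intro: integral_nonneg simp: not_integrable_integral)
    ultimately show ?thesis
      using value_function_eq_cost[OF X t] lam_pos by simp
  qed
  show "V x t \<le> W x t"
  proof -
    obtain C where C: "\<And>x y t s. t \<in> {0..T} \<Longrightarrow> s \<in> {0..T} \<Longrightarrow>
        norm (DW x t - DW y s) \<le> C * norm (x - y) + C * \<bar>t - s\<bar> * (1 + norm x + norm y)"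
      using lip unfolding lipschitz_bounds_def by blast
    define G where "G y s = - ((1 / lam) *\<^sub>R DW y s)" for y s
    have sub: "{t..T} \<subseteq> {0..T}" using t by auto
    have "continuous_on (UNIV \<times> {t..T}) (\<lambda>p. DW (fst p) (snd p))"
      using C1 sub by (auto simp: C1_on_strip_def split_beta elim!: continuous_on_subset)
    then have Gc: "continuous_on (UNIV \<times> {t..T}) (\<lambda>(y, s). G y s)"
      unfolding G_def split_beta by (intro continuous_intros)
    have Gl: "norm (G y s - G z s) \<le> (C / lam) * norm (y - z)" if "s \<in> {t..T}" for y z s
    proof -
      have "G y s - G z s = (1 / lam) *\<^sub>R (DW z s - DW y s)"
        by (simp add: G_def scaleR_diff_right)
      then show ?thesis
        using C[of s s z y] that sub lam_pos
        by (auto simp: norm_minus_commute divide_right_mono)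
    qed
    obtain X where X: "continuous_on {t..T} X"
      "\<And>s. s \<in> {t..T} \<Longrightarrow> X s = x + integral {t..s} (\<lambda>r. G (X r) r)"
      using lipschitz_ode_solution_exists[OF _ Gc Gl, of x] t by auto
    define v where "v s = G (X s) s" for s
    have v: "continuous_on {t..T} v"
    proof -
      have "continuous_on {t..T} (\<lambda>s. (\<lambda>(y, s). G y s) (X s, s))"
        by (rule continuous_on_compose2[OF Gc]) (auto intro!: continuous_intros X)
      then show ?thesis by (simp add: v_def)
    qed
    have "cost lam T F FT x t v
        = W x t + lam / 2 * integral {t..T} (\<lambda>s. (norm (v s + (1 / lam) *\<^sub>R DW (X s) s))\<^sup>2)"
      by (rule verification[OF C1 bellman t v]) (use X(2) in \<open>simp add: v_def[abs_def]\<close>)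
    then have "cost lam T F FT x t v = W x t" by (simp add: v_def G_def)
    then show ?thesis
      using value_function_le_cost[OF t continuous_on_L2_controls[OF v], of x] by simp
  qed
qed

end

section \<open>The value function as the unique solution of the Bellman equation\<close>

theorem theorem1:
  fixes F FT :: "'a::{real_inner, banach} \<Rightarrow> real"
    and DF DFT :: "'a \<Rightarrow> 'a"
    and c T lam :: real
  assumes T_pos: "T > 0"
    and F_grad: "\<And>x. GDERIV F x :> DF x" and F_C1: "continuous_on UNIV DF"
    and FT_grad: "\<And>x. GDERIV FT x :> DFT x" and FT_C1: "continuous_on UNIV DFT"
    and F_lip: "\<And>x1 x2. norm (DF x1 - DF x2) \<le> c * norm (x1 - x2)"
    and FT_lip: "\<And>x1 x2. norm (DFT x1 - DFT x2) \<le> c * norm (x1 - x2)"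
    and F_0: "norm (DF 0) \<le> c"
    and FT_0: "norm (DFT 0) \<le> c"
    and lam: "lam > c * T * (1 + T)"
  shows "(\<exists>DV dV.
            C1_on_strip T (value_function lam T F FT) DV dV \<and>
            growth_bounds T (value_function lam T F FT) DV dV \<and>
            lipschitz_bounds T DV dV \<and>
            bellman_solution lam T F FT (value_function lam T F FT) DV dV) \<and>
         (\<forall>W DW dW.
            C1_on_strip T W DW dW \<and> growth_bounds T W DW dW \<and> lipschitz_bounds T DW dW \<and>
            bellman_solution lam T F FT W DW dW \<longrightarrow>
            (\<forall>x. \<forall>t\<in>{0..T}. W x t = value_function lam T F FT x t)) \<and>
         (\<forall>x. \<forall>t\<in>{0..T}. \<exists>u.
            optimal_control lam T F FT x t u \<and>
            (\<forall>v. optimal_control lam T F FT x t v \<longrightarrow>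
               (AE s in lebesgue_on {t..T}. v s = u s)))"
proof -
  interpret control_problem F FT DF DFT c T lam
    by unfold_locales (use assms in auto)
  show ?thesis
  proof (intro conjI allI ballI impI)
    show "\<exists>DV dV. C1_on_strip T V DV dV \<and> growth_bounds T V DV dV \<and>
        lipschitz_bounds T DV dV \<and> bellman_solution lam T F FT V DV dV"
      using value_function_C1 value_function_growth_bounds value_function_lipschitz_bounds
        value_function_bellman by blast
  next
    fix W DW dW x t
    assume "C1_on_strip T W DW dW \<and> growth_bounds T W DW dW \<and> lipschitz_bounds T DW dW \<and>
        bellman_solution lam T F FT W DW dW" and "t \<in> {0..T}"
    then show "W x t = V x t" by (intro bellman_solution_unique) auto
  next
    fix x t assume t: "t \<in> {0..T}"
    show "\<exists>u. optimal_control lam T F FT x t u \<and>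
        (\<forall>v. optimal_control lam T F FT x t v \<longrightarrow> (AE s in lebesgue_on {t..T}. v s = u s))"
      using control_optimal[OF state_extremal[OF t] t] optimal_control_unique[OF state_extremal[OF t] t]
      by blast
  qed
qed

end
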